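(* Let $K\neq\mathbb{Q}(\sqrt{-3})$ be an imaginary quadratic field. The $K$-Apollonian packings of oriented circles are pairwise disjoint subsets of $\widehat{\mathcal{S}}_K$ whose union is all of $\widehat{\mathcal{S}}_K$.
   Context: Circles in $\widehat{\mathbb{C}}$ include lines. A $K$-Bianchi circle is $M(\widehat{\mathbb{R}})$, $M\in\mathrm{PSL}_2(\mathcal{O}_K)$ acting by Möbius transformations. An oriented circle is a circle with a direction of travel; its interior is the region to the left. $\widehat{\mathcal{S}}_K$ is the set of oriented circles whose underlying circle is a $K$-Bianchi circle. A collection $\mathcal{P}$ of circles straddles an oriented circle $C$ if the union of its circles meets both the interior and the exterior of $C$ nontrivially; $\mathcal{P}$ is tangency-connected if the graph on its circles with edges given by tangency is connected. A $K$-Apollonian packing of oriented circles is a maximal tangency-connected subset of $\widehat{\mathcal{S}}_K$ with pairwise disjoint interiors subject to the condition that it straddles no circle of $\widehat{\mathcal{S}}_K$. *)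

theory Defs
  imports "HOL-Analysis.Analysis" "HOL-Computational_Algebra.Polynomial"
begin

section \<open>Imaginary quadratic fields\<close>

definition complex_subfield :: "complex set \<Rightarrow> bool" where
  "complex_subfield F \<longleftrightarrow> 0 \<in> F \<and> 1 \<in> F \<and>
     (\<forall>x\<in>F. \<forall>y\<in>F. x + y \<in> F \<and> x * y \<in> F) \<and> (\<forall>x\<in>F. - x \<in> F \<and> inverse x \<in> F)"

definition rat_scale :: "rat \<Rightarrow> complex \<Rightarrow> complex" where
  "rat_scale q z = of_rat q * z"

lemma vector_space_rat_scale: "vector_space rat_scale"
  by unfold_locales (simp_all add: rat_scale_def of_rat_add of_rat_mult algebra_simps)

text \<open>Number fields are taken inside the complex numbers. A quadratic field is normal over the
  rationals, so all its embeddings have the same image and no generality is lost.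
  \<open>vector_space.dim rat_scale K\<close> is the degree of \<open>K\<close> over the rationals.\<close>

definition imaginary_quadratic_field :: "complex set \<Rightarrow> bool" where
  "imaginary_quadratic_field K \<longleftrightarrow>
     complex_subfield K \<and> vector_space.dim rat_scale K = 2 \<and> \<not> K \<subseteq> \<real>"

definition rat_adjoin :: "complex \<Rightarrow> complex set" where
  "rat_adjoin a = \<Inter> {F. complex_subfield F \<and> a \<in> F}"

definition ring_of_integers :: "complex set \<Rightarrow> complex set" where
  "ring_of_integers K = {z \<in> K. algebraic_int z}"

section \<open>The extended complex plane\<close>

text \<open>\<open>None\<close> is the point at infinity.\<close>

type_synonym ecomplex = "complex option"

definition extended_real_line :: "ecomplex set" where
  "extended_real_line = insert None (Some ` \<real>)"

definition moebius :: "complex^2^2 \<Rightarrow> ecomplex \<Rightarrow> ecomplex" where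
  "moebius A p = (case p of
     None \<Rightarrow> (if A$2$1 = 0 then None else Some (A$1$1 / A$2$1))
   | Some z \<Rightarrow> (if A$2$1 * z + A$2$2 = 0 then None
               else Some ((A$1$1 * z + A$1$2) / (A$2$1 * z + A$2$2))))"

definition SL2 :: "complex set \<Rightarrow> (complex^2^2) set" where
  "SL2 R = {A. (\<forall>i j. A$i$j \<in> R) \<and> det A = 1}"

text \<open>Two matrices of determinant 1 give the same transformation iff they agree up to sign, so
  \<open>PSL\<^sub>2(R)\<close> is identified with the group of Moebius transformations it induces.\<close>

definition PSL2 :: "complex set \<Rightarrow> (ecomplex \<Rightarrow> ecomplex) set" where
  "PSL2 R = moebius ` SL2 R"

definition bianchi_circles :: "complex set \<Rightarrow> ecomplex set set" where
  "bianchi_circles K = {M ` extended_real_line |M. M \<in> PSL2 (ring_of_integers K)}"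

section \<open>Oriented circles\<close>

datatype sense = Anticlockwise | Clockwise

text \<open>\<open>Round c r s\<close> is the Euclidean circle with centre \<open>c\<close> and radius \<open>r\<close>, travelled in the sense
  \<open>s\<close>. \<open>Straight u h\<close> is the line \<open>{t u + h \<i> u | t real}\<close> together with infinity, travelled in the
  direction of the unit vector \<open>u\<close>; note that \<open>Im (cnj u * z)\<close> is the signed distance of \<open>z\<close> to the
  left of the line through 0 in direction \<open>u\<close>. Under \<open>valid\<close>, different data describe
  different oriented circles; reversal is \<open>Round c r s\<close> with the other sense, respectively
  \<open>Straight (- u) (- h)\<close>.\<close>

datatype ocircle = Round complex real sense | Straight complex real

fun valid :: "ocircle \<Rightarrow> bool" where
  "valid (Round c r s) \<longleftrightarrow> r > 0"
| "valid (Straight u h) \<longleftrightarrow> norm u = 1"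

fun underlying :: "ocircle \<Rightarrow> ecomplex set" where
  "underlying (Round c r s) = Some ` sphere c r"
| "underlying (Straight u h) = insert None (Some ` {z. Im (cnj u * z) = h})"

fun travel_direction :: "ocircle \<Rightarrow> complex \<Rightarrow> complex" where
  "travel_direction (Round c r Anticlockwise) z = \<i> * (z - c) / of_real r"
| "travel_direction (Round c r Clockwise) z = - \<i> * (z - c) / of_real r"
| "travel_direction (Straight u h) z = u"

fun oc_interior :: "ocircle \<Rightarrow> ecomplex set" where
  "oc_interior (Round c r Anticlockwise) = Some ` ball c r"
| "oc_interior (Round c r Clockwise) = insert None (Some ` (- cball c r))"
| "oc_interior (Straight u h) = Some ` {z. Im (cnj u * z) > h}"

definition oc_exterior :: "ocircle \<Rightarrow> ecomplex set" where
  "oc_exterior C = - (underlying C \<union> oc_interior C)"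

text \<open>The interior lies to the left of the direction of travel and the exterior to the right.\<close>

lemma left_of_travel_direction:
  assumes "valid C" "Some z \<in> underlying C"
  shows "\<forall>\<^sub>F e in at_right 0. 
     Some (z + of_real e * (\<i> * travel_direction C z)) \<in> oc_interior C \<and>
     Some (z - of_real e * (\<i> * travel_direction C z)) \<in> oc_exterior C"
proof (cases C)
  case (Straight u h)
  have "cnj u * u = 1"
    using assms(1) complex_norm_square[of u] by (simp add: Straight mult.commute)
  then have "cnj u * (z + of_real e * (\<i> * u)) = cnj u * z + of_real e * \<i>"
            "cnj u * (z - of_real e * (\<i> * u)) = cnj u * z - of_real e * \<i>" for e :: real
    by (simp_all add: algebra_simps)
  then have "Im (cnj u * (z + of_real e * (\<i> * u))) = h + e"
            "Im (cnj u * (z - of_real e * (\<i> * u))) = h - e" for e :: real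
    using assms(2) by (auto simp: Straight simp del: times_complex.simps) auto
  then have "Some (z + of_real e * (\<i> * u)) \<in> oc_interior C \<and>
             Some (z - of_real e * (\<i> * u)) \<in> oc_exterior C" if "e > 0" for e :: real
    using that by (auto simp: Straight oc_exterior_def image_iff simp del: times_complex.simps)
  then show ?thesis
    by (auto simp: Straight intro: eventually_at_rightI[of 0 1])
next
  case (Round c r s)
  define v where "v = (z - c) / of_real r"
  have r: "r > 0" using assms(1) by (simp add: Round)
  have z: "z = c + of_real r * v" and v: "norm v = 1"
    using assms(2) r by (auto simp: Round v_def norm_divide dist_norm norm_minus_commute)
  have d: "dist c (z + of_real x * v) = r + x" if "\<bar>x\<bar> < r" for x :: real
  proof -
    have "c - (z + of_real x * v) = - of_real (r + x) * v" by (simp add: z algebra_simps)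
    then show ?thesis using that by (simp add: dist_norm norm_mult v del: of_real_add)
  qed
  have "Some (z + of_real e * (\<i> * travel_direction C z)) \<in> oc_interior C \<and>
        Some (z - of_real e * (\<i> * travel_direction C z)) \<in> oc_exterior C" 
    if "e > 0" "e < r" for e :: real
  proof (cases s)
    case Anticlockwise
    then have "\<i> * travel_direction C z = - v"
      by (simp add: Round v_def divide_inverse algebra_simps)
    moreover have "z + of_real e * - v \<in> ball c r" "z - of_real e * - v \<notin> cball c r"
      using that d[of e] d[of "-e"] by simp_all
    ultimately show ?thesis
      by (simp only: Round Anticlockwise oc_exterior_def oc_interior.simps underlying.simps) auto
  next
    case Clockwise
    then have "\<i> * travel_direction C z = v"
      by (simp add: Round v_def divide_inverse algebra_simps)
    moreover have "z + of_real e * v \<notin> cball c r" "z - of_real e * v \<in> ball c r"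
      using that d[of e] d[of "-e"] by simp_all
    ultimately show ?thesis
      by (simp only: Round Clockwise oc_exterior_def oc_interior.simps underlying.simps) auto
  qed
  then show ?thesis using r
    by (intro eventually_at_rightI[of 0 r]) auto
qed

definition oriented_bianchi_circles :: "complex set \<Rightarrow> ocircle set" where
  "oriented_bianchi_circles K = {C. valid C \<and> underlying C \<in> bianchi_circles K}"

section \<open>Apollonian packings\<close>

definition straddles :: "ocircle set \<Rightarrow> ocircle \<Rightarrow> bool" where
  "straddles P C \<longleftrightarrow>
     \<Union> (underlying ` P) \<inter> oc_interior C \<noteq> {} \<and> \<Union> (underlying ` P) \<inter> oc_exterior C \<noteq> {}"

text \<open>Parallel lines are tangent at infinity. A circle is not tangent to itself, nor to its reversal.\<close>

definition tangent :: "ocircle \<Rightarrow> ocircle \<Rightarrow> bool" where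
  "tangent C D \<longleftrightarrow> (\<exists>!p. p \<in> underlying C \<inter> underlying D)"

definition tangency_connected :: "ocircle set \<Rightarrow> bool" where
  "tangency_connected P \<longleftrightarrow>
     (\<forall>C\<in>P. \<forall>D\<in>P. (C, D) \<in> {(X, Y). X \<in> P \<and> Y \<in> P \<and> tangent X Y}\<^sup>*)"

definition packing_condition :: "complex set \<Rightarrow> ocircle set \<Rightarrow> bool" where
  "packing_condition K P \<longleftrightarrow>
     P \<subseteq> oriented_bianchi_circles K \<and>
     tangency_connected P \<and>
     pairwise (\<lambda>C D. disjnt (oc_interior C) (oc_interior D)) P \<and>
     (\<forall>C \<in> oriented_bianchi_circles K. \<not> straddles P C)"

definition apollonian_packing :: "complex set \<Rightarrow> ocircle set \<Rightarrow> bool" where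
  "apollonian_packing K P \<longleftrightarrow>
     packing_condition K P \<and> (\<forall>Q. packing_condition K Q \<and> P \<subseteq> Q \<longrightarrow> Q = P)"

end

theory Submission
  imports Defs "HOL-Computational_Algebra.Primes"
begin

text \<open>The union of two packings sharing a circle \<open>C\<close> is again admissible. Indeed, disjointness of the interiors
  keeps every circle of either packing out of the interior of \<open>C\<close>, and both packings lie on one side
  of every circle in the whole family. So if the union straddled \<open>D\<close>, then \<open>C\<close> would lie on \<open>D\<close>; and if
  two distinct circles had overlapping interiors, then each would stay out of the other's interior, which
  for connected interiors forces the circles to coincide. Maximality thus makes distinct packings
  disjoint, and Zorn's lemma extends \<open>{C}\<close> to a packing as soon as no two circles of the family cross.

  For the latter, move one circle to the real line, and the other to the image of it under a
  matrix with entries \<open>a, b, c, d\<close> and determinant 1. The sign of the imaginary part along the second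
  circle is that of a real binary quadratic form of discriminant \<open>- 4 e (1 + e)\<close>, where
  \<open>e = Im a Im d - Im b Im c\<close>. The imaginary parts of the integers of \<open>K\<close> form a lattice \<open>(g/2) \<int>\<close>
  with \<open>g\<^sup>2 \<ge> 4\<close> unless \<open>K\<close> contains \<open>csqrt (-3)\<close>, so \<open>e\<close> avoids the interval \<open>(-1, 0)\<close> and the form is
  semidefinite.\<close>

section \<open>Integers of an imaginary quadratic field\<close>

lemma poly_map_of_int:
  fixes x :: "'a :: comm_ring_1"
  shows poly_map_of_int_add: "poly (map_poly of_int (p + q)) x = poly (map_poly of_int p) x + poly (map_poly of_int q) x"
    and poly_map_of_int_smult: "poly (map_poly of_int (smult c p)) x = of_int c * poly (map_poly of_int p) x"
    and poly_map_of_int_mult: "poly (map_poly of_int (p * q)) x = poly (map_poly of_int p) x * poly (map_poly of_int q) x"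
proof -
  have *: "map_poly of_int (p + q) = map_poly of_int p + (map_poly of_int q :: 'a poly)" for p q
    by (simp add: poly_eq_iff coeff_map_poly)
  then show "poly (map_poly of_int (p + q)) x = poly (map_poly of_int p) x + poly (map_poly of_int q) x"
    by simp
  have "map_poly of_int (smult c p) = smult (of_int c) (map_poly of_int p :: 'a poly)"
    by (simp add: poly_eq_iff coeff_map_poly)
  then show "poly (map_poly of_int (smult c p)) x = of_int c * poly (map_poly of_int p) x"
    by simp
  have "map_poly of_int (p * q) = map_poly of_int p * (map_poly of_int q :: 'a poly)"
    by (simp add: poly_eq_iff coeff_map_poly coeff_mult)
  then show "poly (map_poly of_int (p * q)) x = poly (map_poly of_int p) x * poly (map_poly of_int q) x"
    by simp
qed

text \<open>Gauss's lemma for the minimal polynomial \<open>X\<^sup>2 - 2 (Re z) X + |z|\<^sup>2\<close>.\<close>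

lemma minimal_polynomial_integral:
  fixes z :: complex
  assumes "algebraic_int z" "z \<notin> \<real>" "2 * Re z \<in> \<rat>" "(norm z)\<^sup>2 \<in> \<rat>"
  shows "2 * Re z \<in> \<int>" "(norm z)\<^sup>2 \<in> \<int>"
proof -
  obtain a N where N: "N > 0" and a: "2 * Re z = of_int a / of_int N"
    using assms(3) by (meson Rats_cases')
  obtain b M where M: "M > 0" and b: "(norm z)\<^sup>2 = of_int b / of_int M"
    using assms(4) by (meson Rats_cases')
  \<comment> \<open>\<open>q0\<close> is the minimal polynomial with denominators cleared; dividing
    by its content makes \<open>q\<close> primitive.\<close>
  define q0 :: "int poly" where "q0 = [:b * N, - (a * M), M * N:]"
  define q where "q = primitive_part q0"
  have q0: "q0 \<noteq> 0" "degree q0 = 2" using N M by (auto simp: q0_def)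
  then have q: "content q = 1" "q \<noteq> 0" "degree q = 2" by (simp_all add: q_def)
  have Im: "Im z \<noteq> 0" using assms(2) by (simp add: complex_is_Real_iff)
  have root: "z\<^sup>2 - of_real (2 * Re z) * z + of_real ((norm z)\<^sup>2) = 0"
    by (simp add: complex_eq_iff cmod_power2) (simp add: power2_eq_square algebra_simps)
  have "poly (map_poly of_int q0) z =
      of_int (M * N) * (z\<^sup>2 - of_real (2 * Re z) * z + of_real ((norm z)\<^sup>2))"
    using N M unfolding a b by (simp add: q0_def map_poly_pCons field_simps power2_eq_square)
  then have "poly (map_poly of_int q0) z = 0" unfolding root by simp
  also have "q0 = smult (content q0) q" by (simp add: q_def)
  finally have qz: "poly (map_poly of_int q) z = 0"
    using q0 by (simp add: poly_map_of_int_smult)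
  obtain p :: "int poly" where p: "poly (map_poly of_int p) z = 0" "lead_coeff p = 1"
    using assms(1) by (auto simp: algebraic_int_altdef_ipoly)
  \<comment> \<open>Pseudo-division keeps all coefficients integral at the price of a factor
    \<open>c\<close>. The remainder has degree at most 1 and vanishes at the nonreal
    \<open>z\<close>, so it is 0.\<close>
  define r where "r = pseudo_mod p q"
  obtain c h where c: "c \<noteq> 0" and h: "smult c p = q * h + r"
    using pseudo_mod(1)[OF q(2), of p] by (auto simp: r_def)
  have rz: "poly (map_poly of_int r) z = 0"
    using arg_cong[OF h, of "\<lambda>s. poly (map_poly of_int s) z"] p(1) qz
    by (simp add: poly_map_of_int)
  have "degree r < 2"
    using pseudo_mod(2)[OF q(2), of p] q by (auto simp: r_def)
  have "r = [:coeff r 0, coeff r 1:]"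
  proof (rule poly_eqI)
    fix n show "coeff r n = coeff [:coeff r 0, coeff r 1:] n"
      using \<open>degree r < 2\<close> by (auto simp: coeff_pCons numeral_2_eq_2 coeff_eq_0 split: nat.splits)
  qed
  then obtain r0 r1 where r: "r = [:r0, r1:]" by blast
  have "r = 0"
    using arg_cong[OF rz, of Re] arg_cong[OF rz, of Im] Im by (simp add: r map_poly_pCons)
  \<comment> \<open>A monic polynomial is primitive, so \<open>c\<close> divides the content of
    \<open>h\<close> and with it \<open>lead_coeff h\<close>. As the leading coefficients of
    \<open>q\<close> and \<open>h\<close> multiply to \<open>c\<close>, that of \<open>q\<close> is
    a unit.\<close>
  have "content p = 1"
    by (metis p(2) content_dvd_coeff dvd_1_left is_unit_content_iff)
  then have "content h = \<bar>c\<bar>"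
    using arg_cong[OF h, of content] q(1) \<open>r = 0\<close> by (simp add: content_mult)
  then have "c dvd lead_coeff h"
    by (metis abs_dvd_iff content_dvd_coeff)
  then obtain e where "lead_coeff h = c * e" by blast
  moreover have "lead_coeff q * lead_coeff h = c"
    using arg_cong[OF h, of lead_coeff] p(2) \<open>r = 0\<close> c by (simp add: lead_coeff_mult)
  ultimately have "lead_coeff q * e = 1" using c by simp
  then have lead: "coeff q 2 = 1 \<or> coeff q 2 = - 1"
    by (metis q(3) zmult_eq_1_iff)
  have "q = [:coeff q 0, coeff q 1, coeff q 2:]"
  proof (rule poly_eqI)
    fix n show "coeff q n = coeff [:coeff q 0, coeff q 1, coeff q 2:] n"
      using q(3) by (auto simp: coeff_pCons numeral_2_eq_2 coeff_eq_0 split: nat.splits)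
  qed
  then obtain u v w where quvw: "q = [:u, v, w:]" and w: "w = 1 \<or> w = -1" using lead by blast
  have "of_int u + z * (of_int v + z * of_int w) = 0"
    using qz by (simp add: quvw map_poly_pCons)
  then have re: "u + Re z * (v + Re z * w) - w * (Im z)\<^sup>2 = 0" and im: "(v + 2 * Re z * w) * Im z = 0"
    by (auto simp: complex_eq_iff power2_eq_square algebra_simps)
  from im Im have v: "v = - 2 * Re z * w" by simp
  have "2 * Re z = of_int (- v * w)"
    using v w by auto
  then show "2 * Re z \<in> \<int>" by (simp only: Ints_of_int)
  have "(norm z)\<^sup>2 * w = u"
    using re v unfolding cmod_power2 by (simp add: power2_eq_square algebra_simps)
  then have "(norm z)\<^sup>2 = of_int (u * w)"
    using w by auto
  then show "(norm z)\<^sup>2 \<in> \<int>" by (simp only: Ints_of_int)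
qed

section \<open>Quadratic fields as rational vector spaces\<close>

lemma of_rat_eq_of_real: "of_rat x = complex_of_real (of_rat x)"
  by (cases x rule: Rat_cases) (simp add: Fract_of_int_quotient of_rat_divide)

text \<open>Rational multiples of 1 are real, so \<open>w\<close> is independent of 1; in dimension
  2 the pair is then a basis.\<close>

lemma quadratic_field_span:
  assumes "imaginary_quadratic_field K" "w \<in> K" "w \<notin> \<real>" "z \<in> K"
  obtains x y where "z = of_rat x + of_rat y * w"
proof -
  interpret vs: vector_space rat_scale by (rule vector_space_rat_scale)
  have K: "complex_subfield K" "vs.dim K = 2"
    using assms(1) by (auto simp: imaginary_quadratic_field_def)
  have w: "w \<notin> vs.span {1}"
    using assms(3) by (auto simp: vs.span_singleton rat_scale_def of_rat_eq_of_real)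
  have "vs.independent {1}" by (simp add: vs.independent_insert)
  then have "vs.independent {w, 1}" using w by (simp add: vs.independent_insertI)
  moreover have "{w, 1} \<subseteq> K" using assms K by (auto simp: complex_subfield_def)
  ultimately obtain B where B: "{w, 1} \<subseteq> B" "B \<subseteq> K" "vs.independent B" "K \<subseteq> vs.span B"
    by (metis vs.maximal_independent_subset_extend)
  have "card B = 2" using vs.basis_card_eq_dim B K by auto
  moreover have "card {w, 1} = 2" using assms(3) by (metis Reals_1 card_2_iff)
  ultimately have "B = {w, 1}"
    using B(1) by (metis card_subset_eq card.infinite zero_neq_numeral)
  then have "z \<in> vs.span {w, 1}" using B assms by auto
  then show ?thesis
    by (auto simp: vs.span_breakdown_eq vs.span_singleton rat_scale_def algebra_simps
          intro: that)
qed

text \<open>Writing \<open>v * v\<close> in the basis formed by 1 and a nonreal \<open>v\<close>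
  makes \<open>Re v\<close> and \<open>Im v * Im v\<close> rational, and all other elements reduce
  to \<open>v\<close>.\<close>

lemma quadratic_field_rational:
  assumes K: "imaginary_quadratic_field K" and "z \<in> K" "w \<in> K"
  shows "2 * Re z \<in> \<rat>" "(norm z)\<^sup>2 \<in> \<rat>" "Im z * Im w \<in> \<rat>"
proof -
  obtain v where v: "v \<in> K" "v \<notin> \<real>"
    using K by (auto simp: imaginary_quadratic_field_def)
  have Im: "Im v \<noteq> 0" using v by (simp add: complex_is_Real_iff)
  have span: "\<exists>x\<in>\<rat>. \<exists>y\<in>\<rat>. Re u = x + y * Re v \<and> Im u = y * Im v" if "u \<in> K" for u
  proof -
    obtain x y where "u = of_rat x + of_rat y * v" using quadratic_field_span[OF K v \<open>u \<in> K\<close>] .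
    then show ?thesis
      by (intro bexI[of _ "of_rat x"] bexI[of _ "of_rat y"]) (auto simp: of_rat_eq_of_real)
  qed
  have "v * v \<in> K" using v K by (auto simp: imaginary_quadratic_field_def complex_subfield_def)
  then obtain x y where x: "x \<in> \<rat>" "y \<in> \<rat>"
    "Re v * Re v - Im v * Im v = x + y * Re v" "2 * Re v * Im v = y * Im v"
    using span[of "v * v"] by auto
  have y: "Re v = y / 2" using x(4) Im by simp
  have sq: "Im v * Im v \<in> \<rat>" and Re: "Re v \<in> \<rat>"
  proof -
    show "Re v \<in> \<rat>" using Rats_divide[OF x(2), of 2] unfolding y by simp
    moreover have "Im v * Im v = Re v * Re v - x - y * Re v" using x(3) by simp
    ultimately show "Im v * Im v \<in> \<rat>" using x(1,2) by (metis Rats_diff Rats_mult)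
  qed
  have Im_Im: "Im a * Im b \<in> \<rat>" if ab: "a \<in> K" "b \<in> K" for a b
  proof -
    obtain s t where "s \<in> \<rat>" "t \<in> \<rat>" "Im a = s * Im v" "Im b = t * Im v"
      using span ab by meson
    then have "Im a * Im b = s * t * (Im v * Im v)" by simp
    then show ?thesis using sq \<open>s \<in> \<rat>\<close> \<open>t \<in> \<rat>\<close> by simp
  qed
  show "Im z * Im w \<in> \<rat>" using Im_Im assms by blast
  have "Re z \<in> \<rat>" using span[OF assms(2)] Re by auto
  then show "2 * Re z \<in> \<rat>" "(norm z)\<^sup>2 \<in> \<rat>"
    using Im_Im[OF assms(2,2)] unfolding cmod_power2 by (simp_all add: power2_eq_square)
qed

text \<open>Nonreal elements are covered by Gauss's lemma; a real one is rational, and a rational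
  algebraic integer is an integer.\<close>

lemma ring_of_integers_trace_norm:
  assumes "imaginary_quadratic_field K" "z \<in> ring_of_integers K"
  shows "2 * Re z \<in> \<int>" "(norm z)\<^sup>2 \<in> \<int>"
proof -
  have z: "z \<in> K" "algebraic_int z" using assms by (auto simp: ring_of_integers_def)
  note rat = quadratic_field_rational[OF assms(1) z(1) z(1)]
  have "2 * Re z \<in> \<int> \<and> (norm z)\<^sup>2 \<in> \<int>"
  proof (cases "z \<in> \<real>")
    case False
    then show ?thesis using minimal_polynomial_integral z rat by blast
  next
    case True
    then obtain x where x: "z = of_real x" by (auto elim: Reals_cases)
    have "x \<in> \<rat>" using rat(1) x by (auto dest: Rats_divide[of _ 2])
    then have "x \<in> \<int>" using z x by (auto intro: rational_algebraic_int_is_int)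
    then show ?thesis by (simp add: x)
  qed
  then show "2 * Re z \<in> \<int>" "(norm z)\<^sup>2 \<in> \<int>" by auto
qed

section \<open>Elements with integral trace and norm\<close>

text \<open>Mathematically the ring of integers again, since the two numbers are trace and norm. In
  this form closure and the size of imaginary parts become integer arithmetic.\<close>

definition integral_trace_norm :: "complex set \<Rightarrow> complex set" where
  "integral_trace_norm K = {z \<in> K. 2 * Re z \<in> \<int> \<and> (norm z)\<^sup>2 \<in> \<int>}"

text \<open>The product of the doubled imaginary parts is rational with integral square, hence an
  integer \<open>r\<close>; its square has the parity of that of \<open>t * t'\<close>. The
  resulting \<open>n\<close> is the trace of \<open>z * w\<close>.\<close>

lemma integral_trace_norm_Im_mult:
  assumes K: "imaginary_quadratic_field K"
    and z: "z \<in> integral_trace_norm K" and w: "w \<in> integral_trace_norm K"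
  obtains t t' r n where "2 * Re z = of_int t" "2 * Re w = of_int t'"
    "(2 * Im z) * (2 * Im w) = of_int r" "t * t' - r = 2 * n"
proof -
  obtain t n where t: "2 * Re z = of_int t" and n: "(norm z)\<^sup>2 = of_int n"
    using z unfolding integral_trace_norm_def by (auto elim!: Ints_cases)
  obtain t' n' where t': "2 * Re w = of_int t'" and n': "(norm w)\<^sup>2 = of_int n'"
    using w unfolding integral_trace_norm_def by (auto elim!: Ints_cases)
  have "(2 * Im z)\<^sup>2 = 4 * (norm z)\<^sup>2 - (2 * Re z)\<^sup>2" "(2 * Im w)\<^sup>2 = 4 * (norm w)\<^sup>2 - (2 * Re w)\<^sup>2"
    by (simp_all add: cmod_power2)
  then have sq: "(2 * Im z * (2 * Im w))\<^sup>2 = of_int ((4 * n - t\<^sup>2) * (4 * n' - t'\<^sup>2))"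
    unfolding power_mult_distrib[of "2 * Im z"] by (simp add: t t' n n')
  have "2 * Im z * (2 * Im w) \<in> \<rat>"
    using quadratic_field_rational(3)[OF K, of z w] z w by (auto simp: integral_trace_norm_def)
  moreover have "algebraic_int X" if "X\<^sup>2 = of_int m" for X :: real and m
    by (rule algebraic_int_root[of "of_int m" "monom 1 2"])
      (auto simp: poly_monom degree_monom_eq that)
  ultimately obtain r where r: "2 * Im z * (2 * Im w) = of_int r"
    using rational_algebraic_int_is_int sq by (metis Ints_cases)
  have "of_int (r\<^sup>2) = (of_int ((4 * n - t\<^sup>2) * (4 * n' - t'\<^sup>2)) :: real)"
    using sq r by simp
  then have r2: "r\<^sup>2 = (4 * n - t\<^sup>2) * (4 * n' - t'\<^sup>2)"
    by (simp only: of_int_eq_iff)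
  then have "even (r\<^sup>2) = even (t\<^sup>2 * t'\<^sup>2)" by simp
  then have "even (t * t' - r)" by auto
  then show ?thesis using that t t' r by (metis dvdE)
qed

text \<open>Norms are multiplicative, and \<open>integral_trace_norm_Im_mult\<close> gives the trace
  of a product. The norm of a sum has the trace of \<open>z * cnj w\<close> as cross term.\<close>

lemma integral_trace_norm_ring:
  assumes K: "imaginary_quadratic_field K"
    and z: "z \<in> integral_trace_norm K" and w: "w \<in> integral_trace_norm K"
  shows "z + w \<in> integral_trace_norm K" "- z \<in> integral_trace_norm K" "z * w \<in> integral_trace_norm K"
proof -
  have sub: "complex_subfield K" using K by (simp add: imaginary_quadratic_field_def)
  show m: "- z \<in> integral_trace_norm K"
    using z sub by (auto simp: integral_trace_norm_def complex_subfield_def)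
  have tr: "2 * (Re z * Re w - Im z * Im w) \<in> \<int>"
    if z: "z \<in> integral_trace_norm K" and w: "w \<in> integral_trace_norm K" for z w
  proof -
    obtain t t' r n where "2 * Re z = of_int t" "2 * Re w = of_int t'"
      "(2 * Im z) * (2 * Im w) = of_int r" "t * t' - r = 2 * n"
      using integral_trace_norm_Im_mult[OF K z w] .
    moreover have "2 * (2 * (Re z * Re w - Im z * Im w)) = (2 * Re z) * (2 * Re w) - (2 * Im z) * (2 * Im w)"
      by (simp add: algebra_simps)
    ultimately have "2 * (2 * (Re z * Re w - Im z * Im w)) = of_int (2 * n)"
      by (simp flip: of_int_mult of_int_diff)
    then have "2 * (Re z * Re w - Im z * Im w) = of_int n" by simp
    then show ?thesis by (metis Ints_of_int)
  qed
  have "(norm (z * w))\<^sup>2 \<in> \<int>"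
    using z w by (simp add: norm_mult power_mult_distrib integral_trace_norm_def)
  then show "z * w \<in> integral_trace_norm K"
    using tr[OF z w] z w sub by (auto simp: integral_trace_norm_def complex_subfield_def)
  \<comment> \<open>Since \<open>cnj w\<close> is the trace of \<open>w\<close> minus
    \<open>w\<close>, this trace is a product of traces minus the trace of
    \<open>z * w\<close>.\<close>
  have cw: "2 * (Re z * Re w + Im z * Im w) \<in> \<int>"
  proof -
    have "2 * (Re z * Re w + Im z * Im w) = (2 * Re z) * (2 * Re w) - 2 * (Re z * Re w - Im z * Im w)"
      by (simp add: algebra_simps)
    moreover have "2 * Re z \<in> \<int>" "2 * Re w \<in> \<int>" using z w by (auto simp: integral_trace_norm_def)
    ultimately show ?thesis using tr[OF z w] by (metis Ints_diff Ints_mult)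
  qed
  have "(norm (z + w))\<^sup>2 = (norm z)\<^sup>2 + (norm w)\<^sup>2 + 2 * (Re z * Re w + Im z * Im w)"
    unfolding cmod_power2 by (simp add: power2_eq_square algebra_simps)
  then have "(norm (z + w))\<^sup>2 \<in> \<int>"
    using cw z w by (auto simp: integral_trace_norm_def)
  then show "z + w \<in> integral_trace_norm K"
    using z w sub by (auto simp: integral_trace_norm_def complex_subfield_def distrib_left)
qed

section \<open>Generators of the field and the lattice of imaginary parts\<close>

lemma complex_subfield_of_rat:
  assumes "complex_subfield F"
  shows "of_rat x \<in> F"
proof -
  have nat: "of_nat n \<in> F" for n
    by (induction n) (use assms in \<open>auto simp: complex_subfield_def\<close>)
  have int: "of_int k \<in> F" for k
    by (cases k rule: int_cases2) (use nat assms in \<open>auto simp: complex_subfield_def\<close>)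
  obtain a b where "x = Fract a b" "b \<noteq> 0" by (cases x rule: Rat_cases) auto
  then have "of_rat x = of_int a * inverse (of_int b :: complex)"
    by (simp add: Fract_of_int_quotient of_rat_divide) (simp add: divide_inverse)
  then show ?thesis using int assms by (simp add: complex_subfield_def)
qed

text \<open>Serves to recognise the excluded field from a single nonreal element.\<close>

lemma quadratic_field_eq_rat_adjoin:
  assumes "imaginary_quadratic_field K" "w \<in> K" "w \<notin> \<real>"
  shows "K = rat_adjoin w"
proof
  show "rat_adjoin w \<subseteq> K"
    using assms by (auto simp: rat_adjoin_def imaginary_quadratic_field_def)
  show "K \<subseteq> rat_adjoin w"
  proof
    fix z assume "z \<in> K"
    then obtain x y where z: "z = of_rat x + of_rat y * w"
      using quadratic_field_span assms by blast
    have "z \<in> F" if "complex_subfield F" "w \<in> F" for F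
      using that complex_subfield_of_rat[OF that(1)] unfolding z by (simp add: complex_subfield_def)
    then show "z \<in> rat_adjoin w" by (simp add: rat_adjoin_def)
  qed
qed

text \<open>\<open>(2 Im z)\<^sup>2\<close> is minus the discriminant of the minimal polynomial of \<open>z\<close>, hence 0 or 3 modulo 4.\<close>

lemma integral_Im_square_ge_4:
  assumes K: "imaginary_quadratic_field K" "K \<noteq> rat_adjoin (csqrt (-3))"
    and z: "z \<in> integral_trace_norm K" and "Im z > 0"
  shows "(2 * Im z)\<^sup>2 \<ge> 4"
proof -
  obtain t n where t: "2 * Re z = of_int t" and n: "(norm z)\<^sup>2 = of_int n"
    using z unfolding integral_trace_norm_def by (auto elim!: Ints_cases)
  have "(2 * Im z)\<^sup>2 = 4 * (norm z)\<^sup>2 - (2 * Re z)\<^sup>2"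
    by (simp add: cmod_power2)
  then have eq: "(2 * Im z)\<^sup>2 = of_int (4 * n - t\<^sup>2)" by (simp add: t n)
  have "of_int (4 * n - t\<^sup>2) > (0 :: real)"
    unfolding eq[symmetric] using assms(4) by simp
  then have pos: "4 * n - t\<^sup>2 > 0" by (simp only: of_int_0_less_iff)
  \<comment> \<open>The value 3 would put \<open>z + z - t\<close>, which is then
    \<open>csqrt (-3)\<close>, into \<open>K\<close>, and this element generates
    \<open>K\<close>.\<close>
  have "4 * n - t\<^sup>2 \<noteq> 3"
  proof
    assume "4 * n - t\<^sup>2 = 3"
    then have "(2 * Im z)\<^sup>2 = 3" using eq by simp
    then have Im: "2 * Im z = sqrt 3" using assms(4) by (intro real_sqrt_unique[symmetric]) auto
    let ?v = "z + z + of_int (- t)"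
    have v: "?v = csqrt (-3)"
      using Im t by (simp add: complex_eq_iff csqrt_of_real_nonpos)
    have sub: "complex_subfield K" using K(1) by (simp add: imaginary_quadratic_field_def)
    have "z \<in> K" using z by (simp add: integral_trace_norm_def)
    then have "?v \<in> K"
      using sub complex_subfield_of_rat[OF sub, of "of_int (- t)"]
      unfolding complex_subfield_def of_rat_of_int_eq by blast
    moreover have "?v \<notin> \<real>" using assms(4) by (simp add: complex_is_Real_iff)
    ultimately show False using quadratic_field_eq_rat_adjoin[OF K(1), of ?v] K(2) v by simp
  qed
  moreover have "t\<^sup>2 mod 4 \<in> {0, 1}"
  proof (cases "even t")
    case True
    then show ?thesis by (auto elim!: evenE simp: power_mult_distrib)
  next
    case False
    then obtain k where "t = 2 * k + 1" by (auto elim: oddE)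
    then have "t\<^sup>2 = 1 + 4 * (k\<^sup>2 + k)" by (simp add: power2_eq_square algebra_simps)
    then have "t\<^sup>2 mod 4 = 1 mod 4" by (simp only: mod_mult_self2)
    then show ?thesis by simp
  qed
  ultimately have "4 * n - t\<^sup>2 \<ge> 4" using pos by simp presburger
  then have "of_int (4 * n - t\<^sup>2) \<ge> (of_int 4 :: real)" by (simp only: of_int_le_iff)
  then show ?thesis using eq by simp
qed

text \<open>Division with remainder by an element of least positive imaginary part, as for subgroups
  of the integers.\<close>

lemma integral_trace_norm_Im_generator:
  assumes K: "imaginary_quadratic_field K" "K \<noteq> rat_adjoin (csqrt (-3))"
  obtains g where "g\<^sup>2 \<ge> 4" "\<And>z. z \<in> integral_trace_norm K \<Longrightarrow> \<exists>k. 2 * Im z = of_int k * g"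
proof (cases "\<exists>z \<in> integral_trace_norm K. Im z \<noteq> 0")
  case False
  then have "\<exists>k. 2 * Im z = of_int k * 2" if "z \<in> integral_trace_norm K" for z
    using that by (intro exI[of _ 0]) auto
  then show ?thesis using that[of 2] by simp
next
  case True
  let ?R = "integral_trace_norm K"
  \<comment> \<open>On the ring \<open>(2 * Im z)^2\<close> is an integer; read as a natural number
    it attains a minimum.\<close>
  define sz where "sz = (\<lambda>z. nat \<lfloor>(2 * Im z)\<^sup>2\<rfloor>)"
  have sz: "of_nat (sz z) = (2 * Im z)\<^sup>2" if z: "z \<in> ?R" for z
  proof -
    obtain r where "(2 * Im z) * (2 * Im z) = of_int r"
      using integral_trace_norm_Im_mult[OF K(1) z z] .
    then have r: "(2 * Im z)\<^sup>2 = of_int r" by (simp add: power2_eq_square)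
    then have "r \<ge> 0" by (metis of_int_0_le_iff zero_le_power2)
    then show ?thesis unfolding sz_def r by simp
  qed
  obtain z0 where z0: "z0 \<in> ?R" "Im z0 > 0"
  proof -
    obtain w where w: "w \<in> ?R" "Im w \<noteq> 0" using True by blast
    show ?thesis
    proof (cases "Im w > 0")
      case True
      then show ?thesis using that w by blast
    next
      case False
      then show ?thesis using that[of "- w"] w integral_trace_norm_ring(2)[OF K(1) w(1) w(1)] by simp
    qed
  qed
  define z where "z = arg_min sz (\<lambda>z. z \<in> ?R \<and> Im z > 0)"
  have z: "z \<in> ?R" "Im z > 0" 
    using arg_min_natI[of "\<lambda>z. z \<in> ?R \<and> Im z > 0" z0 sz] z0 by (auto simp: z_def)
  have min: "sz z \<le> sz w" if "w \<in> ?R" "Im w > 0" for w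
    unfolding z_def by (rule arg_min_nat_le) (use that in simp)
  have "\<exists>k. 2 * Im w = of_int k * (2 * Im z)" if w: "w \<in> ?R" for w
  proof -
    have sub: "complex_subfield K" using K(1) by (simp add: imaginary_quadratic_field_def)
    \<comment> \<open>Rounding down puts the imaginary part of the remainder \<open>?u\<close> into
      the interval from 0 to below \<open>Im z\<close>; minimality then forces it to be 0.\<close>
    define k where "k = \<lfloor>Im w / Im z\<rfloor>"
    have int: "of_int j \<in> ?R" for j
      using complex_subfield_of_rat[OF sub, of "of_int j"]
      by (simp add: integral_trace_norm_def power2_abs)
    let ?u = "w + - (of_int k * z)"
    have "of_int k * z \<in> ?R" by (rule integral_trace_norm_ring(3)[OF K(1) int z(1)])
    then have "- (of_int k * z) \<in> ?R" by (rule integral_trace_norm_ring(2)[OF K(1) _ w])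
    then have u: "?u \<in> ?R" by (rule integral_trace_norm_ring(1)[OF K(1) w])
    have Im: "Im ?u = Im w - of_int k * Im z" by simp
    have "of_int k \<le> Im w / Im z" "Im w / Im z < of_int k + 1" unfolding k_def by (auto simp: floor_correct)
    then have "Im ?u \<ge> 0" "Im ?u < Im z" unfolding Im using z by (simp_all add: field_simps)
    moreover have "\<not> Im ?u > 0"
    proof
      assume pos: "Im ?u > 0"
      have "real (sz z) \<le> real (sz ?u)" by (rule of_nat_mono[OF min[OF u pos]])
      then have "(2 * Im z)\<^sup>2 \<le> (2 * Im ?u)\<^sup>2" by (simp only: sz[OF u] sz[OF z(1)])
      moreover have "0 \<le> 2 * Im ?u" using pos by linarith
      ultimately have "2 * Im z \<le> 2 * Im ?u" by (rule power2_le_imp_le)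
      then show False using \<open>Im ?u < Im z\<close> by linarith
    qed
    ultimately have "Im w = of_int k * Im z" using Im by linarith
    then show ?thesis by (intro exI[of _ k]) simp
  qed
  then show ?thesis
    using that[of "2 * Im z"] integral_Im_square_ge_4[OF K z] by blast
qed

text \<open>\<open>e\<close> is an integer multiple of \<open>g^2 / 4\<close>, which is at least 1,
  so \<open>e\<close> is nonnegative or at most -1.\<close>

lemma integral_Im_det:
  assumes K: "imaginary_quadratic_field K" "K \<noteq> rat_adjoin (csqrt (-3))"
    and "a \<in> integral_trace_norm K" "b \<in> integral_trace_norm K"
        "c \<in> integral_trace_norm K" "d \<in> integral_trace_norm K"
  defines "e \<equiv> Im a * Im d - Im b * Im c"
  shows "e * (1 + e) \<ge> 0"
proof -
  obtain g where g: "g\<^sup>2 \<ge> 4" "\<And>z. z \<in> integral_trace_norm K \<Longrightarrow> \<exists>k. 2 * Im z = of_int k * g"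
    using integral_trace_norm_Im_generator[OF K] by metis
  obtain i j k l where "2 * Im a = of_int i * g" "2 * Im b = of_int j * g"
    "2 * Im c = of_int k * g" "2 * Im d = of_int l * g"
    using g(2) assms(3-6) by metis
  then have *: "Im a = of_int i * g / 2" "Im b = of_int j * g / 2"
    "Im c = of_int k * g / 2" "Im d = of_int l * g / 2" by auto
  have e: "e = of_int (i * l - j * k) * (g\<^sup>2 / 4)"
    unfolding e_def * by (simp add: power2_eq_square field_simps)
  show ?thesis
  proof (cases "i * l - j * k \<ge> 0")
    case True
    then have "of_int (i * l - j * k) \<ge> (0 :: real)" by (simp only: of_int_0_le_iff)
    then have "e \<ge> 0" unfolding e by (intro mult_nonneg_nonneg) auto
    then show ?thesis by simp
  next
    case False
    then have "i * l - j * k \<le> -1" by simp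
    then have "of_int (i * l - j * k) \<le> (of_int (-1) :: real)" by (simp only: of_int_le_iff)
    then have "e \<le> -1 * (g\<^sup>2 / 4)" unfolding e by (intro mult_right_mono) auto
    then have "e \<le> -1" using g(1) by simp
    then show ?thesis by (simp add: mult_nonpos_nonpos)
  qed
qed

section \<open>The binary quadratic form of two circles\<close>

text \<open>The discriminant is the squared modulus of the determinant minus the square of its real
  part increased by \<open>2 * e\<close>; determinant 1 leaves
  \<open>1 - (1 + 2 * e)^2\<close>.\<close>

lemma cross_form_disc:
  fixes a b c d :: complex
  assumes "a * d - b * c = 1"
  defines "e \<equiv> Im a * Im d - Im b * Im c"
  shows "(Im (a * cnj d + b * cnj c))\<^sup>2 - 4 * Im (a * cnj c) * Im (b * cnj d) = - 4 * e * (1 + e)"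
proof -
  obtain a1 a2 where a: "a = Complex a1 a2" by (cases a)
  obtain b1 b2 where b: "b = Complex b1 b2" by (cases b)
  obtain c1 c2 where c: "c = Complex c1 c2" by (cases c)
  obtain d1 d2 where d: "d = Complex d1 d2" by (cases d)
  have "a1 * d1 - a2 * d2 - b1 * c1 + b2 * c2 = 1" "a1 * d2 + a2 * d1 - b1 * c2 - b2 * c1 = 0"
    using assms by (simp_all add: a b c d complex_eq_iff)
  moreover have "(a2 * d1 - a1 * d2 + b2 * c1 - b1 * c2)\<^sup>2
     - 4 * (a2 * c1 - a1 * c2) * (b2 * d1 - b1 * d2) 
     = (a1 * d1 - a2 * d2 - b1 * c1 + b2 * c2)\<^sup>2 + (a1 * d2 + a2 * d1 - b1 * c2 - b2 * c1)\<^sup>2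
      - (a1 * d1 - a2 * d2 - b1 * c1 + b2 * c2 + 2 * (a2 * d2 - b2 * c2))\<^sup>2"
    unfolding power2_eq_square by (simp only: algebra_simps)
  ultimately have "(a2 * d1 - a1 * d2 + b2 * c1 - b1 * c2)\<^sup>2
     - 4 * (a2 * c1 - a1 * c2) * (b2 * d1 - b1 * d2) = 1 - (1 + 2 * e)\<^sup>2"
    by (simp add: e_def a b c d)
  moreover have "1 - (1 + 2 * e)\<^sup>2 = - 4 * e * (1 + e)"
    by (simp add: power2_eq_square algebra_simps)
  moreover have "Im (a * cnj d + b * cnj c) = a2 * d1 - a1 * d2 + b2 * c1 - b1 * c2"
    "Im (a * cnj c) = a2 * c1 - a1 * c2" "Im (b * cnj d) = b2 * d1 - b1 * d2"
    by (simp_all add: a b c d)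
  ultimately show ?thesis by simp
qed

text \<open>Completing the square shows that \<open>4 * p\<close> times any value of the form is
  nonnegative. Values of both signs force \<open>p = 0\<close>, hence \<open>q = 0\<close>, and what
  is left is \<open>r * y^2\<close>, of constant sign.\<close>

lemma semidefinite_form:
  fixes p q r :: real
  assumes "q\<^sup>2 - 4 * p * r \<le> 0" "p * x\<^sup>2 + q * x * y + r * y\<^sup>2 > 0"
  shows "p * u\<^sup>2 + q * u * v + r * v\<^sup>2 \<ge> 0"
proof (rule ccontr)
  let ?f = "\<lambda>x y. p * x\<^sup>2 + q * x * y + r * y\<^sup>2"
  have sq: "4 * p * ?f x y = (2 * p * x + q * y)\<^sup>2 - (q\<^sup>2 - 4 * p * r) * y\<^sup>2" for x y
    by (simp add: power2_eq_square algebra_simps)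
  have nn: "4 * p * ?f x y \<ge> 0" for x y
    using mult_nonpos_nonneg[OF assms(1), of "y\<^sup>2", OF zero_le_power2] zero_le_power2[of "2 * p * x + q * y"] unfolding sq by linarith
  assume *: "\<not> ?f u v \<ge> 0"
  have "p \<ge> 0" 
  proof (rule ccontr)
    assume "\<not> p \<ge> 0"
    then have "4 * p < 0" by simp
    from mult_neg_pos[OF this assms(2)] show False using nn[of x y] by linarith
  qed
  moreover have "p \<le> 0" 
  proof (rule ccontr)
    assume "\<not> p \<le> 0"
    then have "4 * p > 0" by simp
    from mult_pos_neg[OF this, of "?f u v"] * show False using nn[of u v] by linarith
  qed
  ultimately have "p = 0" "q = 0" using assms(1) by auto
  then have "r * y\<^sup>2 > 0" using assms(2) by simp
  then have "r \<ge> 0" by (simp add: zero_less_mult_iff)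
  then show False using * \<open>p = 0\<close> \<open>q = 0\<close> by simp
qed

section \<open>Oriented circles and their sides\<close>

text \<open>Exteriors become interiors of the reversed circle, so facts about interiors transfer to
  exteriors.\<close>

primrec reverse_circle :: "ocircle \<Rightarrow> ocircle" where
  "reverse_circle (Round c r s) = Round c r (case s of Anticlockwise \<Rightarrow> Clockwise | Clockwise \<Rightarrow> Anticlockwise)"
| "reverse_circle (Straight u h) = Straight (- u) (- h)"

lemma valid_reverse [simp]: "valid (reverse_circle C) = valid C"
  by (cases C) auto

lemma underlying_reverse [simp]: "underlying (reverse_circle C) = underlying C"
  by (cases C) auto

lemma reverse_reverse [simp]: "reverse_circle (reverse_circle C) = C"
  by (cases C) (auto split: sense.splits)

lemma oc_interior_reverse [simp]: "oc_interior (reverse_circle C) = oc_exterior C"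
proof (cases C)
  case (Round c r s)
  show ?thesis
  proof (rule set_eqI)
    fix p show "p \<in> oc_interior (reverse_circle C) \<longleftrightarrow> p \<in> oc_exterior C"
      by (cases p; cases s) (auto simp: Round oc_exterior_def image_iff)
  qed
next
  case (Straight u h)
  show ?thesis
  proof (rule set_eqI)
    fix p show "p \<in> oc_interior (reverse_circle C) \<longleftrightarrow> p \<in> oc_exterior C"
      by (cases p) (auto simp: Straight oc_exterior_def image_iff)
  qed
qed

lemma oc_exterior_reverse [simp]: "oc_exterior (reverse_circle C) = oc_interior C"
  by (metis oc_interior_reverse reverse_reverse)

section \<open>Sides of a circle in the finite plane\<close>

text \<open>Dropping infinity from interior and circle makes the topology of \<open>complex\<close>
  available.\<close>

definition region :: "ocircle \<Rightarrow> complex set" where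
  "region C = {z. Some z \<in> oc_interior C}"

definition boundary :: "ocircle \<Rightarrow> complex set" where
  "boundary C = {z. Some z \<in> underlying C}"

lemma region_simps:
  "region (Round c r Anticlockwise) = ball c r"
  "region (Round c r Clockwise) = - cball c r"
  "region (Straight u h) = {z. Im (cnj u * z) > h}"
  by (auto simp: region_def)

lemma boundary_simps:
  "boundary (Round c r s) = sphere c r"
  "boundary (Straight u h) = {z. Im (cnj u * z) = h}"
  by (auto simp: boundary_def)

lemma boundary_reverse [simp]: "boundary (reverse_circle C) = boundary C"
  by (simp add: boundary_def)

lemma open_region: "open (region C)"
proof (cases C)
  case (Round c r s)
  then show ?thesis by (cases s) (auto simp: region_simps)
next
  case (Straight u h)
  show ?thesis unfolding Straight region_simps
    by (intro open_Collect_less continuous_intros)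
qed

lemma connected_region: "connected (region C)"
proof (cases C)
  case (Round c r s)
  then show ?thesis
    by (cases s) (auto simp: region_simps intro: connected_complement_bounded_convex)
next
  case (Straight u h)
  have "region C = (\<lambda>z. Im (cnj u * z)) -` {h<..}" by (auto simp: Straight region_simps)
  moreover have "linear (\<lambda>z. Im (cnj u * z))"
    by (rule linearI) (auto simp: algebra_simps)
  ultimately have "convex (region C)" by (simp add: convex_linear_vimage)
  then show ?thesis by (rule convex_connected)
qed

lemma region_cases:
  obtains "z \<in> region C" | "z \<in> boundary C" | "z \<in> region (reverse_circle C)"
  by (auto simp: region_def boundary_def oc_exterior_def)

lemma region_disjoint:
  "region C \<inter> boundary C = {}" "region C \<inter> region (reverse_circle C) = {}"
proof -
  show "region C \<inter> boundary C = {}"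
  proof (cases C)
    case (Round c r s)
    then show ?thesis by (cases s) (auto simp: region_simps boundary_simps)
  next
    case (Straight u h)
    then show ?thesis by (auto simp: region_simps boundary_simps)
  qed
  show "region C \<inter> region (reverse_circle C) = {}"
    by (auto simp: region_def oc_exterior_def)
qed

lemma unbounded_boundary:
  assumes "valid C" "None \<in> underlying C"
  shows "\<not> bounded (boundary C)"
proof
  assume "bounded (boundary C)"
  then obtain B where B: "\<And>z. z \<in> boundary C \<Longrightarrow> norm z \<le> B" by (auto simp: bounded_iff)
  obtain u h where C: "C = Straight u h" using assms(2) by (cases C) auto
  have u: "norm u = 1" using assms(1) C by simp
  then have uu: "cnj u * u = 1" by (metis complex_norm_square mult.commute of_real_1 power_one)
  \<comment> \<open>\<open>u * ?w\<close> is a point of the line more than \<open>B\<close> away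
    from the origin.\<close>
  let ?w = "Complex (\<bar>B\<bar> + 1) h"
  have "Im (cnj u * (u * ?w)) = h" by (simp only: mult.assoc[symmetric] uu mult_1 complex.sel)
  then have "u * ?w \<in> boundary C" by (simp only: C boundary_simps mem_Collect_eq)
  then have "norm ?w \<le> B" using B u by (metis mult_1 norm_mult)
  moreover have "\<bar>B\<bar> + 1 \<le> norm ?w" using complex_Re_le_cmod[of ?w] by simp
  ultimately show False by linarith
qed

lemma bounded_compl_region:
  assumes "None \<in> oc_interior C"
  shows "bounded (- region C)"
proof (cases C)
  case (Round c r s)
  then show ?thesis using assms by (cases s) (auto simp: region_simps)
next
  case (Straight u h)
  then show ?thesis using assms by auto
qed

text \<open>A common point at infinity can be traded for a finite one: \<open>boundary D\<close> is
  unbounded, whereas the complement of \<open>region C\<close> is bounded.\<close>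

lemma underlying_meets_interior:
  assumes "valid D" "underlying D \<inter> oc_interior C \<noteq> {}"
  shows "boundary D \<inter> region C \<noteq> {}"
proof -
  obtain p where p: "p \<in> underlying D" "p \<in> oc_interior C" using assms(2) by blast
  show ?thesis
  proof (cases p)
    case None
    then show ?thesis
      using unbounded_boundary[OF assms(1)] bounded_compl_region p bounded_subset
      by (metis disjoint_eq_subset_Compl)
  next
    case (Some z)
    then show ?thesis using p by (auto simp: boundary_def region_def)
  qed
qed

text \<open>If infinity is a common point, both regions have bounded complements, and these cannot
  cover the plane.\<close>

lemma interiors_meet:
  assumes "oc_interior C \<inter> oc_interior D \<noteq> {}"
  shows "region C \<inter> region D \<noteq> {}"
proof -
  obtain p where p: "p \<in> oc_interior C" "p \<in> oc_interior D" using assms by blast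
  show ?thesis
  proof (cases p)
    case None
    then have "bounded (- region C \<union> - region D)"
      using bounded_compl_region[of C] bounded_compl_region[of D] p by (simp add: bounded_Un)
    then have "- region C \<union> - region D \<noteq> UNIV" by (metis not_bounded_UNIV)
    then show ?thesis by blast
  next
    case (Some z)
    then show ?thesis using p by (auto simp: region_def)
  qed
qed

text \<open>A small step to the left of the direction of travel enters the region and stays in
  \<open>U\<close>.\<close>

lemma region_near_boundary:
  assumes "valid D" "z \<in> boundary D" "z \<in> U" "open U"
  shows "region D \<inter> U \<noteq> {}"
proof -
  let ?f = "\<lambda>e::real. z + of_real e * (\<i> * travel_direction D z)"
  have "\<forall>\<^sub>F e in at_right 0. ?f e \<in> region D"
    using left_of_travel_direction[OF assms(1), of z] assms(2)
    by (auto simp: boundary_def region_def elim: eventually_mono)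
  moreover have "(?f \<longlongrightarrow> z) (at_right 0)"
    by (auto intro!: tendsto_eq_intros)
  then have "\<forall>\<^sub>F e in at_right 0. ?f e \<in> U"
    using assms by (auto dest: topological_tendstoD)
  ultimately have "\<forall>\<^sub>F e in at_right 0. ?f e \<in> region D \<inter> U"
    by eventually_elim auto
  then show ?thesis using eventually_happens' trivial_limit_at_right_real by blast
qed

lemma disjoint_interiors_imp_underlying:
  assumes "valid D" "oc_interior C \<inter> oc_interior D = {}"
  shows "underlying D \<inter> oc_interior C = {}"
proof (rule ccontr)
  assume "underlying D \<inter> oc_interior C \<noteq> {}"
  then obtain z where "z \<in> boundary D" "z \<in> region C"
    using underlying_meets_interior assms(1) by blast
  then have "region D \<inter> region C \<noteq> {}"
    using region_near_boundary assms(1) open_region by blast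
  then show False using assms(2) by (auto simp: region_def)
qed

text \<open>The connected set \<open>region C\<close> avoids \<open>boundary D\<close>, so it lies
  in one of the two open sides of \<open>D\<close>.\<close>

lemma region_subset:
  assumes "underlying D \<inter> oc_interior C = {}" "region C \<inter> region D \<noteq> {}"
  shows "region C \<subseteq> region D"
proof -
  have "region C \<subseteq> region D \<union> region (reverse_circle D)"
  proof
    fix z assume "z \<in> region C"
    then have "z \<notin> boundary D" using assms(1) by (auto simp: region_def boundary_def)
    then show "z \<in> region D \<union> region (reverse_circle D)" by (metis UnCI region_cases)
  qed
  then have "region C \<inter> region (reverse_circle D) = {}"
    using connectedD[OF connected_region open_region open_region, of D "reverse_circle D" C]
      region_disjoint(2)[of D] assms(2) by blast
  then show ?thesis using \<open>region C \<subseteq> _\<close> by blast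
qed

section \<open>Recovering a circle from its points\<close>

text \<open>The extreme points of the first circle in the four axis directions suffice: subtracting
  the equations of opposite ones gives equal centres.\<close>

lemma sphere_subset_imp_eq:
  fixes c d :: complex
  assumes "sphere c r \<subseteq> sphere d s" "r > 0" "s > 0"
  shows "c = d \<and> r = s"
proof -
  have *: "(Re (c + v - d))\<^sup>2 + (Im (c + v - d))\<^sup>2 = s\<^sup>2" if "norm v = r" for v
  proof -
    have "c + v \<in> sphere c r" using that by (simp add: dist_norm)
    then have "c + v \<in> sphere d s" using assms(1) by blast
    then have "norm (d - (c + v)) = s" by (simp add: dist_norm)
    then have "norm (c + v - d) = s" by (metis norm_minus_commute)
    then show ?thesis by (metis cmod_power2)
  qed
  have 1: "(Re c - Re d + r)\<^sup>2 + (Im c - Im d)\<^sup>2 = s\<^sup>2" "(Re c - Re d - r)\<^sup>2 + (Im c - Im d)\<^sup>2 = s\<^sup>2"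
    "(Re c - Re d)\<^sup>2 + (Im c - Im d + r)\<^sup>2 = s\<^sup>2" "(Re c - Re d)\<^sup>2 + (Im c - Im d - r)\<^sup>2 = s\<^sup>2"
    using *[of "Complex r 0"] *[of "Complex (-r) 0"] *[of "Complex 0 r"] *[of "Complex 0 (-r)"] assms(2)
    by (simp_all add: complex_norm algebra_simps)
  have "4 * r * x = (x + r)\<^sup>2 - (x - r)\<^sup>2" for x
    by (simp add: power2_eq_square algebra_simps)
  from this[of "Re c - Re d"] this[of "Im c - Im d"] 1
  have "4 * r * (Re c - Re d) = 0" "4 * r * (Im c - Im d) = 0" by linarith+
  then have "Re c = Re d" "Im c = Im d" using assms(2) by auto
  moreover from this have "r\<^sup>2 = s\<^sup>2" using 1(1) by simp
  then have "r = s" using assms by (simp add: power2_eq_iff_nonneg)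
  ultimately show ?thesis by (simp add: complex_eq_iff)
qed

lemma boundary_subset_imp_eq:
  assumes "valid C" "valid D" "boundary C \<subseteq> boundary D"
  shows "D = C \<or> D = reverse_circle C"
proof (cases C)
  case C: (Round c r s)
  show ?thesis
  proof (cases D)
    case D: (Round c' r' s')
    have "c = c' \<and> r = r'"
      using sphere_subset_imp_eq assms by (auto simp: C D boundary_simps)
    then show ?thesis unfolding C D by (cases s; cases s') auto
  next
    case D: (Straight u h)
    have r: "r > 0" "norm u = 1" using assms by (auto simp: C D)
    have *: "Im (cnj u * (c + of_real r * v)) = h" if "norm v = 1" for v
    proof -
      have "c + of_real r * v \<in> boundary C" using that r by (simp add: C boundary_simps dist_norm norm_mult)
      then show ?thesis using assms(3) by (auto simp: D boundary_simps simp del: times_complex.simps)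
    qed
    have uu: "cnj u * u = 1" using r by (metis complex_norm_square mult.commute of_real_1 power_one)
    \<comment> \<open>Two opposite points of the circle have heights over the line differing by
      \<open>2 * r\<close>, yet both would have height \<open>h\<close>.\<close>
    have "cnj u * (c + of_real r * (\<i> * u)) = cnj u * c + of_real r * \<i> * (cnj u * u)"
      "cnj u * (c + of_real r * (- \<i> * u)) = cnj u * c - of_real r * \<i> * (cnj u * u)"
      by (simp_all add: algebra_simps)
    then have "Im (cnj u * c + of_real r * \<i>) = h" "Im (cnj u * c - of_real r * \<i>) = h"
      using *[of "\<i> * u"] *[of "- \<i> * u"] r uu by (simp_all add: norm_mult del: times_complex.simps)
    then have "r = 0" by simp
    then show ?thesis using r by simp
  qed
next
  case C: (Straight u h)
  show ?thesis
  proof (cases D)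
    case D: (Round c' r' s')
    then have "bounded (boundary C)" using assms(3) bounded_sphere bounded_subset by (metis boundary_simps(1))
    moreover have "None \<in> underlying C" by (simp add: C)
    ultimately show ?thesis using unbounded_boundary assms(1) by blast
  next
    case D: (Straight v k)
    have nu: "norm u = 1" "norm v = 1" using assms by (auto simp: C D)
    then have uu: "cnj u * u = 1" "cnj v * v = 1"
      by (metis complex_norm_square mult.commute of_real_1 power_one)+
    have *: "Im (cnj v * u * Complex t h) = k" for t
    proof -
      have "Im (cnj u * (u * Complex t h)) = h"
        by (simp only: mult.assoc[symmetric] uu mult_1 complex.sel)
      then have "u * Complex t h \<in> boundary C" by (simp only: C boundary_simps mem_Collect_eq)
      then have "u * Complex t h \<in> boundary D" using assms(3) by blast
      then show ?thesis by (simp add: D boundary_simps mult.assoc del: times_complex.simps)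
    qed
    \<comment> \<open>The quotient of the two unit directions; constant height along the line makes
      it real, hence 1 or -1.\<close>
    define w where "w = cnj v * u"
    have w: "Im w = 0" "h * Re w = k"
      using *[of 0] *[of 1] unfolding w_def[symmetric] by auto
    have "norm w = 1" using nu by (simp add: w_def norm_mult)
    then have "\<bar>Re w\<bar> = 1" using w(1) by (simp add: cmod_eq_Re)
    then have "w = 1 \<or> w = -1" using w(1) by (auto simp: complex_eq_iff abs_if split: if_splits)
    moreover have "v * w = u" using uu(2) unfolding w_def
      by (metis mult.assoc mult.commute mult_1)
    ultimately show ?thesis using w(2) by (auto simp: C D)
  qed
qed

lemma reverse_neq: "valid C \<Longrightarrow> reverse_circle C \<noteq> C"
  by (cases C) (auto split: sense.splits)

lemma boundary_subset_of_disjoint: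
  assumes "valid C" "underlying C \<inter> oc_interior D = {}" "underlying C \<inter> oc_exterior D = {}"
  shows "boundary C \<subseteq> boundary D"
proof
  fix z assume "z \<in> boundary C"
  then show "z \<in> boundary D"
    using assms(2,3) by (cases z D rule: region_cases) (auto simp: boundary_def region_def)
qed

text \<open>Mutual inclusion makes the regions equal. Points of \<open>region C\<close> accumulate
  at \<open>boundary C\<close>, which therefore cannot enter the far side of \<open>D\<close>; the
  overlap excludes opposite orientations.\<close>

lemma eq_of_overlapping:
  assumes "valid C" "valid D" "underlying C \<inter> oc_interior D = {}" "underlying D \<inter> oc_interior C = {}"
    "oc_interior C \<inter> oc_interior D \<noteq> {}"
  shows "C = D"
proof -
  have ne: "region C \<inter> region D \<noteq> {}" by (rule interiors_meet[OF assms(5)])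
  then have eq: "region C = region D"
    using region_subset[of D C] region_subset[of C D] assms by (metis Int_commute subset_antisym)
  have "boundary C \<subseteq> boundary D"
  proof
    fix z assume z: "z \<in> boundary C"
    show "z \<in> boundary D"
    proof (cases z D rule: region_cases)
      case 1
      then show ?thesis using z assms(3) by (auto simp: boundary_def region_def)
    next
      case 3
      then have "region C \<inter> region (reverse_circle D) \<noteq> {}"
        using region_near_boundary assms(1) z open_region by blast
      then show ?thesis using eq region_disjoint(2)[of D] by simp
    qed
  qed
  then have "D = C \<or> D = reverse_circle C" using boundary_subset_imp_eq assms by blast
  moreover have "D \<noteq> reverse_circle C"
    using ne region_disjoint(2)[of C] by auto
  ultimately show ?thesis by simp
qed

section \<open>Bianchi circles do not cross\<close>

lemma SL2_det: "A \<in> SL2 R \<Longrightarrow> A$1$1 * A$2$2 - A$1$2 * A$2$1 = 1"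
  by (simp add: SL2_def det_2)

text \<open>The sign of \<open>side_form A z\<close> is that of the imaginary part of \<open>A\<^sup>-\<^sup>1 z\<close>.\<close>

definition side_form :: "complex^2^2 \<Rightarrow> complex \<Rightarrow> real" where
  "side_form A z = Im ((A$2$2 * z - A$1$2) * cnj (A$1$1 - A$2$1 * z))"

lemma image_extended_real_line_iff:
  "Some z \<in> moebius A ` extended_real_line \<longleftrightarrow>
    (A$2$1 \<noteq> 0 \<and> z = A$1$1 / A$2$1) \<or>
    (\<exists>t::real. A$2$1 * t + A$2$2 \<noteq> 0 \<and> z = (A$1$1 * t + A$1$2) / (A$2$1 * t + A$2$2))"
  (is "?L \<longleftrightarrow> ?R")
proof
  assume ?L
  then obtain p where p: "p \<in> extended_real_line" "Some z = moebius A p" by blast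
  then show ?R by (auto simp: extended_real_line_def moebius_def elim!: Reals_cases split: if_splits)
next
  assume ?R
  then show ?L
  proof
    assume "A$2$1 \<noteq> 0 \<and> z = A$1$1 / A$2$1"
    then show ?L by (intro image_eqI[of _ _ None]) (auto simp: extended_real_line_def moebius_def)
  next
    assume "\<exists>t::real. A$2$1 * t + A$2$2 \<noteq> 0 \<and> z = (A$1$1 * t + A$1$2) / (A$2$1 * t + A$2$2)"
    then obtain t :: real where "A$2$1 * t + A$2$2 \<noteq> 0" "z = (A$1$1 * t + A$1$2) / (A$2$1 * t + A$2$2)" by blast
    then show ?L by (intro image_eqI[of _ _ "Some (of_real t)"]) (auto simp: extended_real_line_def moebius_def)
  qed
qed

text \<open>Homogeneous coordinates treat infinity, as \<open>(1, 0)\<close>, and a real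
  \<open>t\<close>, as \<open>(t, 1)\<close>, alike.\<close>

lemma image_extended_real_lineD:
  assumes "Some z \<in> moebius A ` extended_real_line"
  obtains x y :: real where "A$2$1 * x + A$2$2 * y \<noteq> 0"
    "z = (A$1$1 * x + A$1$2 * y) / (A$2$1 * x + A$2$2 * y)"
proof -
  consider "A$2$1 \<noteq> 0" "z = A$1$1 / A$2$1"
    | t :: real where "A$2$1 * t + A$2$2 \<noteq> 0" "z = (A$1$1 * t + A$1$2) / (A$2$1 * t + A$2$2)"
    using assms unfolding image_extended_real_line_iff by blast
  then show ?thesis
  proof cases
    case 1
    then show ?thesis using that[of 1 0] by simp
  next
    case (2 t)
    then show ?thesis using that[of t 1] by simp
  qed
qed

text \<open>The inverse matrix, applied to the vector \<open>(z, 1)\<close>, returns the homogeneous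
  coordinates up to the common denominator.\<close>

lemma moebius_preimage:
  fixes a b c d p q :: complex
  assumes "a * d - b * c = 1" "c * p + d * q \<noteq> 0" "z = (a * p + b * q) / (c * p + d * q)"
  shows "d * z - b = p / (c * p + d * q)" "a - c * z = q / (c * p + d * q)"
proof -
  have "d * (a * p + b * q) - b * (c * p + d * q) = (a * d - b * c) * p"
    "a * (c * p + d * q) - c * (a * p + b * q) = (a * d - b * c) * q"
    by (simp_all add: algebra_simps)
  then show "d * z - b = p / (c * p + d * q)" "a - c * z = q / (c * p + d * q)"
    using assms by (simp_all add: field_simps)
qed

text \<open>A common denominator changes the form only by a positive factor.\<close>

lemma Im_divide_mult_cnj: "Im (p / w * cnj (q / w)) = Im (p * cnj q) / (norm w)\<^sup>2"
proof -
  have "p / w * cnj (q / w) = p * cnj q / of_real ((norm w)\<^sup>2)"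
    by (simp only: complex_norm_square complex_cnj_divide times_divide_times_eq)
  then show ?thesis by (simp only: Im_divide_of_real)
qed

lemma side_form_eq_0_iff:
  assumes det: "A$1$1 * A$2$2 - A$1$2 * A$2$1 = 1"
  shows "side_form A z = 0 \<longleftrightarrow> Some z \<in> moebius A ` extended_real_line"
proof
  assume "Some z \<in> moebius A ` extended_real_line"
  then obtain x y :: real where xy: "A$2$1 * x + A$2$2 * y \<noteq> 0"
    "z = (A$1$1 * x + A$1$2 * y) / (A$2$1 * x + A$2$2 * y)"
    by (rule image_extended_real_lineD)
  show "side_form A z = 0"
    unfolding side_form_def moebius_preimage[OF det xy] Im_divide_mult_cnj by simp
next
  assume 0: "side_form A z = 0"
  let ?u = "A$2$2 * z - A$1$2" and ?v = "A$1$1 - A$2$1 * z"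
  show "Some z \<in> moebius A ` extended_real_line"
  proof (cases "?v = 0")
    case True
    then have "A$2$1 \<noteq> 0" using det by auto
    then show ?thesis using True unfolding image_extended_real_line_iff by (auto simp: field_simps)
  next
    case False
    have "Im (?u / ?v) = 0"
      using 0 False unfolding side_form_def complex_div_cnj[of ?u ?v] by (simp del: times_complex.simps)
    then obtain t where t: "?u / ?v = complex_of_real t" by (metis complex_is_Real_iff Reals_cases)
    \<comment> \<open>\<open>?u\<close> and \<open>?v\<close> are homogeneous coordinates of the
      preimage of \<open>z\<close>; applying \<open>A\<close> returns the vector
      \<open>(z, 1)\<close>.\<close>
    have "A$2$1 * ?u + A$2$2 * ?v = A$1$1 * A$2$2 - A$1$2 * A$2$1"
      "A$1$1 * ?u + A$1$2 * ?v = (A$1$1 * A$2$2 - A$1$2 * A$2$1) * z" by (simp_all add: algebra_simps)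
    then have "A$2$1 * ?u + A$2$2 * ?v = 1" "A$1$1 * ?u + A$1$2 * ?v = z" using det by simp_all
    moreover have "?u = t * ?v" using t by (simp only: nonzero_divide_eq_eq[OF False])
    moreover have "(p * t + q) * v = p * (t * v) + q * v" for p q v :: complex
      by (simp add: algebra_simps)
    ultimately have v: "(A$2$1 * t + A$2$2) * ?v = 1" and z: "(A$1$1 * t + A$1$2) * ?v = z"
      by simp_all
    from v have "A$2$1 * t + A$2$2 \<noteq> 0" by (metis mult_zero_left zero_neq_one)
    moreover from this v have "?v = 1 / (A$2$1 * t + A$2$2)"
      by (metis nonzero_mult_div_cancel_left)
    with z have "z = (A$1$1 * t + A$1$2) / (A$2$1 * t + A$2$2)"
      by (metis times_divide_eq_right mult.right_neutral)
    ultimately show ?thesis unfolding image_extended_real_line_iff by blast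
  qed
qed

text \<open>The image of a point on the imaginary axis, on the side prescribed by \<open>s\<close>,
  has the required sign. At most one point is sent to infinity, so a scaling \<open>k\<close> of 1
  or 2 gives a finite image.\<close>

lemma side_form_attains:
  assumes det: "A$1$1 * A$2$2 - A$1$2 * A$2$1 = 1" and "s \<noteq> 0"
  obtains z where "side_form A z * s > 0"
proof -
  have "\<exists>k::real. k > 0 \<and> A$2$1 * (\<i> * of_real (k * s)) + A$2$2 * 1 \<noteq> 0"
  proof (rule ccontr)
    assume "\<not> ?thesis"
    then have "A$2$1 * (\<i> * of_real (k * s)) + A$2$2 = 0" if "k > 0" for k :: real
      using that by (metis mult.right_neutral)
    from this[of 1] this[of 2]
    have *: "A$2$1 * (\<i> * of_real s) + A$2$2 = 0" "2 * (A$2$1 * (\<i> * of_real s)) + A$2$2 = 0"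
      by (simp_all add: mult_ac)
    then have "2 * (A$2$1 * (\<i> * of_real s)) = A$2$1 * (\<i> * of_real s)"
      by (metis add_right_cancel)
    then have "A$2$1 * (\<i> * of_real s) = 0" by simp
    with * have "A$2$1 = 0" "A$2$2 = 0" using assms(2) by auto
    then show False using det by simp
  qed
  then obtain k :: real where k: "k > 0" "A$2$1 * (\<i> * of_real (k * s)) + A$2$2 * 1 \<noteq> 0" by blast
  define w where "w = A$2$1 * (\<i> * of_real (k * s)) + A$2$2 * 1"
  define z where "z = (A$1$1 * (\<i> * of_real (k * s)) + A$1$2 * 1) / (A$2$1 * (\<i> * of_real (k * s)) + A$2$2 * 1)"
  have "side_form A z = k * s / (norm w)\<^sup>2"
    unfolding side_form_def moebius_preimage[OF det k(2) z_def] Im_divide_mult_cnj w_def by simp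
  then have "side_form A z * s = k * s\<^sup>2 / (norm w)\<^sup>2" by (simp add: power2_eq_square)
  moreover have "w \<noteq> 0" using k(2) w_def by simp
  ultimately have "side_form A z * s > 0" using k(1) assms(2) by simp
  then show ?thesis by (rule that)
qed

lemma connected_nonzero_sign:
  fixes f :: "'a::topological_space \<Rightarrow> real"
  assumes "connected S" "continuous_on S f" "\<And>x. x \<in> S \<Longrightarrow> f x \<noteq> 0" "x \<in> S" "y \<in> S"
  shows "f x * f y > 0"
proof (rule ccontr)
  assume "\<not> f x * f y > 0"
  then have "f x \<le> 0 \<and> 0 \<le> f y \<or> f y \<le> 0 \<and> 0 \<le> f x"
    by (auto simp: zero_less_mult_iff not_less)
  moreover have "connected (f ` S)" using assms connected_continuous_image by blast
  ultimately have "0 \<in> f ` S" using assms(4,5) connectedD_interval by blast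
  then show False using assms(3) by auto
qed

text \<open>The form has constant sign on each connected side and vanishes only on the circle. Since
  it takes both signs, the two sides must have different ones.\<close>

lemma side_form_opposite:
  assumes det: "A$1$1 * A$2$2 - A$1$2 * A$2$1 = 1"
    and D: "underlying D = moebius A ` extended_real_line"
    and z: "z \<in> region D" "w \<in> region (reverse_circle D)"
  shows "side_form A z * side_form A w < 0"
proof -
  have cont: "continuous_on S (side_form A)" for S
    unfolding side_form_def by (intro continuous_intros)
  have nz: "side_form A x \<noteq> 0 \<longleftrightarrow> x \<notin> boundary D" for x
    by (simp add: side_form_eq_0_iff[OF det] boundary_def D)
  have same: "side_form A x * side_form A y > 0" if "x \<in> region E" "y \<in> region E" "E = D \<or> E = reverse_circle D" for x y E
  proof (rule connected_nonzero_sign[OF connected_region cont _ that(1,2)])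
    fix x assume "x \<in> region E"
    then have "x \<notin> boundary E" using region_disjoint(1)[of E] by blast
    then show "side_form A x \<noteq> 0" using that(3) by (auto simp: nz)
  qed
  have "side_form A z \<noteq> 0" using same[of z D z] z by auto
  then obtain v where v: "side_form A v * - side_form A z > 0"
    using side_form_attains[OF det, of "- side_form A z"] by auto
  then have "side_form A v \<noteq> 0" by auto
  then have "v \<notin> boundary D" using nz by blast
  moreover have "v \<notin> region D"
    using same[of v D z] z v by auto
  ultimately have "v \<in> region (reverse_circle D)" using region_cases by blast
  then have "side_form A v * side_form A w > 0" using same z by blast
  then show ?thesis using v by (auto simp: zero_less_mult_iff mult_less_0_iff)
qed

text \<open>These are the coefficients whose discriminant \<open>cross_form_disc\<close>
  computes.\<close>

lemma quadratic_form_expand: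
  fixes a b c d :: complex and x y :: real
  shows "Im ((a * x + b * y) * cnj (c * x + d * y)) =
    Im (a * cnj c) * x\<^sup>2 + Im (a * cnj d + b * cnj c) * x * y + Im (b * cnj d) * y\<^sup>2"
  by (simp add: power2_eq_square algebra_simps)

lemma bianchi_circles_do_not_cross:
  assumes K: "imaginary_quadratic_field K" "K \<noteq> rat_adjoin (csqrt (-3))"
    and C: "C \<in> oriented_bianchi_circles K" and D: "D \<in> oriented_bianchi_circles K"
  shows "underlying C \<inter> oc_interior D = {} \<or> underlying C \<inter> oc_exterior D = {}"
proof (rule ccontr)
  assume *: "\<not> ?thesis"
  have valid: "valid C" "valid D" using C D by (auto simp: oriented_bianchi_circles_def)
  obtain z where z: "z \<in> boundary C" "z \<in> region D"
    using underlying_meets_interior[OF valid(1), of D] * by auto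
  obtain w where w: "w \<in> boundary C" "w \<in> region (reverse_circle D)"
    using underlying_meets_interior[OF valid(1), of "reverse_circle D"] * by auto
  obtain A where A: "A \<in> SL2 (ring_of_integers K)" "underlying D = moebius A ` extended_real_line"
    using D by (auto simp: oriented_bianchi_circles_def bianchi_circles_def PSL2_def)
  obtain B where B: "B \<in> SL2 (ring_of_integers K)" "underlying C = moebius B ` extended_real_line"
    using C by (auto simp: oriented_bianchi_circles_def bianchi_circles_def PSL2_def)
  note detA = SL2_det[OF A(1)] and detB = SL2_det[OF B(1)]
  let ?R = "integral_trace_norm K"
  have "ring_of_integers K \<subseteq> ?R"
    using ring_of_integers_trace_norm[OF K(1)]
    by (auto simp: integral_trace_norm_def ring_of_integers_def)
  then have R: "A$i$j \<in> ?R" "B$i$j \<in> ?R" for i j using A B by (auto simp: SL2_def)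
  have diff: "p * q - r * s \<in> ?R" if "p \<in> ?R" "q \<in> ?R" "r \<in> ?R" "s \<in> ?R" for p q r s
  proof -
    have "p * q \<in> ?R" "r * s \<in> ?R" using integral_trace_norm_ring(3)[OF K(1)] that by auto
    then have "p * q + - (r * s) \<in> ?R"
      by (metis integral_trace_norm_ring(1,2)[OF K(1)])
    then show ?thesis by simp
  qed
  \<comment> \<open>\<open>a\<close>, \<open>b\<close>, \<open>c\<close>, \<open>d\<close> are the
    entries of the inverse of \<open>A\<close> times \<open>B\<close>, which carries the real line
    to \<open>C\<close> as seen from \<open>D\<close>.\<close>
  define a where "a = A$2$2 * B$1$1 - A$1$2 * B$2$1"
  define b where "b = A$2$2 * B$1$2 - A$1$2 * B$2$2"
  define c where "c = A$1$1 * B$2$1 - A$2$1 * B$1$1"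
  define d where "d = A$1$1 * B$2$2 - A$2$1 * B$1$2"
  have "a * d - b * c = (A$1$1 * A$2$2 - A$1$2 * A$2$1) * (B$1$1 * B$2$2 - B$1$2 * B$2$1)"
    unfolding a_def b_def c_def d_def by (simp add: algebra_simps)
  then have det: "a * d - b * c = 1" using detA detB by simp
  have abcd: "a \<in> ?R" "b \<in> ?R" "c \<in> ?R" "d \<in> ?R"
    unfolding a_def b_def c_def d_def by (intro diff R)+
  let ?P = "Im (a * cnj c)" and ?Q = "Im (a * cnj d + b * cnj c)" and ?S = "Im (b * cnj d)"
  have disc: "?Q\<^sup>2 - 4 * ?P * ?S \<le> 0"
  proof -
    have "- 4 * e * (1 + e) \<le> 0" if "e * (1 + e) \<ge> 0" for e :: real
      using that by (simp add: mult.assoc)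
    from this[OF integral_Im_det[OF K abcd]] show ?thesis unfolding cross_form_disc[OF det] .
  qed
  have form: "\<exists>x y n. n > 0 \<and> side_form A u = (?P * x\<^sup>2 + ?Q * x * y + ?S * y\<^sup>2) / n"
    if "u \<in> boundary C" for u
  proof -
    have "Some u \<in> moebius B ` extended_real_line" using that by (simp add: boundary_def B)
    then obtain x y :: real where xy: "B$2$1 * x + B$2$2 * y \<noteq> 0"
      "u = (B$1$1 * x + B$1$2 * y) / (B$2$1 * x + B$2$2 * y)"
      by (rule image_extended_real_lineD)
    let ?w = "B$2$1 * x + B$2$2 * y"
    have "A$2$2 * u - A$1$2 = (a * x + b * y) / ?w" "A$1$1 - A$2$1 * u = (c * x + d * y) / ?w"
      using xy(1) unfolding xy(2) a_def b_def c_def d_def by (simp_all add: field_simps)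
    then have "side_form A u = (?P * x\<^sup>2 + ?Q * x * y + ?S * y\<^sup>2) / (norm ?w)\<^sup>2"
      unfolding side_form_def by (simp only: Im_divide_mult_cnj quadratic_form_expand)
    moreover have "(norm ?w)\<^sup>2 > 0" using xy(1) by simp
    ultimately show ?thesis by blast
  qed
  have nonneg: "side_form A v \<ge> 0" if u: "u \<in> boundary C" and v: "v \<in> boundary C" and pos: "side_form A u > 0" for u v
  proof -
    obtain x y n where n: "n > 0" "side_form A u = (?P * x\<^sup>2 + ?Q * x * y + ?S * y\<^sup>2) / n"
      using form[OF u] by blast
    obtain x' y' n' where n': "n' > 0" "side_form A v = (?P * x'\<^sup>2 + ?Q * x' * y' + ?S * y'\<^sup>2) / n'"
      using form[OF v] by blast
    have "?P * x\<^sup>2 + ?Q * x * y + ?S * y\<^sup>2 > 0" using n pos by (simp add: zero_less_divide_iff)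
    then have "?P * x'\<^sup>2 + ?Q * x' * y' + ?S * y'\<^sup>2 \<ge> 0" by (rule semidefinite_form[OF disc])
    then show ?thesis unfolding n'(2) using n'(1) by (intro divide_nonneg_pos) auto
  qed
  have "side_form A z * side_form A w < 0" by (rule side_form_opposite[OF detA A(2) z(2) w(2)])
  then show False
    using nonneg[OF z(1) w(1)] nonneg[OF w(1) z(1)] by (auto simp: mult_less_0_iff)
qed

section \<open>Packings\<close>

lemma packing_valid:
  assumes "packing_condition K P" "C \<in> P"
  shows "valid C"
  using assms by (auto simp: packing_condition_def oriented_bianchi_circles_def)

lemma packing_disjoint:
  assumes "packing_condition K P" "C \<in> P" "D \<in> P" "C \<noteq> D"
  shows "oc_interior C \<inter> oc_interior D = {}"
  using assms by (auto simp: packing_condition_def pairwise_def disjnt_def)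

text \<open>A circle has two distinct points: opposite ones if it is round, infinity and a finite
  one if it is straight.\<close>

lemma not_tangent_same_underlying:
  assumes "valid C" "underlying C = underlying D"
  shows "\<not> tangent C D"
proof -
  have "\<exists>p\<in>underlying C. \<exists>q\<in>underlying C. p \<noteq> q"
  proof (cases C)
    case (Round c r s)
    then have "c + of_real r \<in> sphere c r" "c - of_real r \<in> sphere c r" "c + of_real r \<noteq> c - of_real r"
      using assms(1) by (auto simp: dist_norm complex_eq_iff)
    then show ?thesis by (metis Round image_eqI option.inject underlying.simps(1))
  next
    case (Straight u h)
    have "\<not> bounded (boundary C)" using unbounded_boundary[OF assms(1)] Straight by simp
    then obtain z where "z \<in> boundary C" by (metis bounded_empty equals0I)
    then show ?thesis by (auto simp: Straight boundary_def)
  qed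
  then show ?thesis using assms(2) unfolding tangent_def by auto
qed

lemma packing_underlying_disjoint:
  assumes "packing_condition K P" "C \<in> P" "D \<in> P"
  shows "underlying D \<inter> oc_interior C = {}"
proof (cases "C = D")
  case True
  have "underlying C \<inter> oc_interior C = {}"
  proof (rule ccontr)
    assume "underlying C \<inter> oc_interior C \<noteq> {}"
    then have "boundary C \<inter> region C \<noteq> {}"
      using underlying_meets_interior packing_valid assms by blast
    then show False using region_disjoint(1)[of C] by blast
  qed
  then show ?thesis using True by simp
next
  case False
  then show ?thesis
    using disjoint_interiors_imp_underlying packing_valid packing_disjoint assms by metis
qed

text \<open>A packing containing both orientations of a circle has no room for any other circle, and a circle
  is not tangent to its reversal.\<close>

lemma packing_reverse_notin:
  assumes P: "packing_condition K P" and C: "C \<in> P"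
  shows "reverse_circle C \<notin> P"
proof
  assume rC: "reverse_circle C \<in> P"
  have all: "X = C \<or> X = reverse_circle C" if X: "X \<in> P" for X
  proof -
    have "underlying X \<inter> oc_interior C = {}" "underlying X \<inter> oc_exterior C = {}"
      using packing_underlying_disjoint[OF P _ X] C rC oc_interior_reverse by metis+
    then have "boundary X \<subseteq> boundary C"
      using boundary_subset_of_disjoint packing_valid[OF P X] by blast
    then have "C = X \<or> C = reverse_circle X"
      using boundary_subset_imp_eq packing_valid[OF P] X C by blast
    then show ?thesis by auto
  qed
  let ?E = "{(X, Y). X \<in> P \<and> Y \<in> P \<and> tangent X Y}"
  have "(C, reverse_circle C) \<in> ?E\<^sup>*"
    using P C rC by (auto simp: packing_condition_def tangency_connected_def)
  moreover have "C \<noteq> reverse_circle C" using reverse_neq packing_valid[OF P C] by metis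
  ultimately obtain X where X: "(C, X) \<in> ?E" by (blast elim: converse_rtranclE)
  then have "underlying C = underlying X" using all[of X] by auto
  then show False using X not_tangent_same_underlying packing_valid[OF P C] by auto
qed

section \<open>Unions of packings with a common circle\<close>

lemma tangency_connected_Un:
  assumes "tangency_connected P" "tangency_connected Q" "C \<in> P" "C \<in> Q"
  shows "tangency_connected (P \<union> Q)"
  unfolding tangency_connected_def
proof (intro ballI)
  let ?E = "\<lambda>S. {(X, Y). X \<in> S \<and> Y \<in> S \<and> tangent X Y}"
  have mono: "(?E P)\<^sup>* \<subseteq> (?E (P \<union> Q))\<^sup>*" "(?E Q)\<^sup>* \<subseteq> (?E (P \<union> Q))\<^sup>*"
    by (intro rtrancl_mono; blast)+
  have to_C: "(X, C) \<in> (?E (P \<union> Q))\<^sup>* \<and> (C, X) \<in> (?E (P \<union> Q))\<^sup>*" if "X \<in> P \<union> Q" for X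
    using that assms mono unfolding tangency_connected_def by blast
  fix X Y assume "X \<in> P \<union> Q" "Y \<in> P \<union> Q"
  then show "(X, Y) \<in> (?E (P \<union> Q))\<^sup>*"
    by (rule rtrancl_trans[OF conjunct1[OF to_C] conjunct2[OF to_C]])
qed

text \<open>As neither packing straddles \<open>D\<close>, they lie on opposite sides of it, so the
  shared \<open>C\<close> lies on \<open>D\<close>. Then \<open>x\<close> or \<open>y\<close> is a
  point of a packing inside \<open>C\<close>, whichever orientation \<open>D\<close> has.\<close>

lemma shared_circle_same_side:
  assumes P: "packing_condition K P" and Q: "packing_condition K Q"
    and C: "C \<in> P" "C \<in> Q" and D: "D \<in> oriented_bianchi_circles K"
    and x: "x \<in> \<Union> (underlying ` P)" "x \<in> oc_interior D"
    and y: "y \<in> \<Union> (underlying ` Q)" "y \<in> oc_exterior D"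
  shows False
proof -
  have valid: "valid C" "valid D"
    using packing_valid[OF P C(1)] D by (auto simp: oriented_bianchi_circles_def)
  have "\<Union> (underlying ` P) \<inter> oc_exterior D = {}" "\<Union> (underlying ` Q) \<inter> oc_interior D = {}"
    using P Q D x y unfolding packing_condition_def straddles_def by blast+
  then have "underlying C \<inter> oc_interior D = {}" "underlying C \<inter> oc_exterior D = {}"
    using C by blast+
  then have "boundary C \<subseteq> boundary D" using boundary_subset_of_disjoint valid by blast
  then consider "D = C" | "D = reverse_circle C" using boundary_subset_imp_eq valid by blast
  then show False
  proof cases
    case 1
    then show False using packing_underlying_disjoint[OF P C(1)] x by blast
  next
    case 2
    then show False using packing_underlying_disjoint[OF Q C(2)] y by auto
  qed
qed

text \<open>Otherwise \<open>Q\<close>, and with it \<open>C\<close>, would miss the exterior of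
  \<open>X\<close>. As a member of \<open>P\<close>, \<open>C\<close> also misses its interior, so
  \<open>X\<close> is \<open>C\<close> or its reversal; neither is possible.\<close>

lemma overlapping_circle_avoids_interior:
  assumes P: "packing_condition K P" and Q: "packing_condition K Q"
    and C: "C \<in> P" "C \<in> Q" and X: "X \<in> P" and Y: "Y \<in> Q"
    and meet: "oc_interior X \<inter> oc_interior Y \<noteq> {}" and "X \<notin> Q"
  shows "underlying Y \<inter> oc_interior X = {}"
proof (rule ccontr)
  assume "underlying Y \<inter> oc_interior X \<noteq> {}"
  moreover have "X \<in> oriented_bianchi_circles K" using P X by (auto simp: packing_condition_def)
  then have "\<not> straddles Q X" using Q by (auto simp: packing_condition_def)
  ultimately have "\<Union> (underlying ` Q) \<inter> oc_exterior X = {}"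
    using Y unfolding straddles_def by blast
  then have "underlying C \<inter> oc_exterior X = {}" using C by blast
  then have "boundary C \<subseteq> boundary X"
    using boundary_subset_of_disjoint packing_underlying_disjoint[OF P X C(1)] packing_valid[OF P C(1)]
    by blast
  then have "X = C \<or> X = reverse_circle C"
    using boundary_subset_imp_eq packing_valid[OF P] C X by blast
  then show False using assms(8) C packing_reverse_notin[OF P C(1)] X by auto
qed

lemma packing_condition_Un:
  assumes P: "packing_condition K P" and Q: "packing_condition K Q" and C: "C \<in> P" "C \<in> Q"
  shows "packing_condition K (P \<union> Q)"
proof -
  have overlap: "X = Y" if X: "X \<in> P" and Y: "Y \<in> Q" and meet: "oc_interior X \<inter> oc_interior Y \<noteq> {}" for X Y
  proof (rule ccontr)
    assume "X \<noteq> Y"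
    then have "X \<notin> Q" "Y \<notin> P" using packing_disjoint[OF Q _ Y] packing_disjoint[OF P X] X Y meet by blast+
    then have "underlying Y \<inter> oc_interior X = {}" "underlying X \<inter> oc_interior Y = {}"
      using overlapping_circle_avoids_interior[OF P Q C X Y meet] overlapping_circle_avoids_interior[OF Q P C(2,1) Y X] meet by blast+
    then have "X = Y"
      using eq_of_overlapping packing_valid[OF P X] packing_valid[OF Q Y] meet by blast
    then show False using \<open>X \<noteq> Y\<close> by simp
  qed
  have "pairwise (\<lambda>C D. disjnt (oc_interior C) (oc_interior D)) (P \<union> Q)"
    unfolding pairwise_def disjnt_def
  proof (intro ballI impI)
    fix X Y assume "X \<in> P \<union> Q" "Y \<in> P \<union> Q" "X \<noteq> Y"
    then show "oc_interior X \<inter> oc_interior Y = {}"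
      using overlap[of X Y] overlap[of Y X] packing_disjoint[OF P, of X Y] packing_disjoint[OF Q, of X Y]
      by blast
  qed
  moreover have "\<not> straddles (P \<union> Q) D" if D: "D \<in> oriented_bianchi_circles K" for D
  proof
    assume "straddles (P \<union> Q) D"
    then obtain x y where x: "x \<in> \<Union> (underlying ` (P \<union> Q))" "x \<in> oc_interior D"
      and y: "y \<in> \<Union> (underlying ` (P \<union> Q))" "y \<in> oc_exterior D"
      unfolding straddles_def by blast
    have "\<not> straddles P D" "\<not> straddles Q D" using P Q D by (auto simp: packing_condition_def)
    \<comment> \<open>Neither packing straddles \<open>D\<close> alone, so the witnesses come from
      different packings.\<close>
    then consider "x \<in> \<Union> (underlying ` P)" "y \<in> \<Union> (underlying ` Q)"
      | "x \<in> \<Union> (underlying ` Q)" "y \<in> \<Union> (underlying ` P)"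
      using x y unfolding straddles_def by blast
    then show False
      using shared_circle_same_side[OF P Q C D] shared_circle_same_side[OF Q P C(2,1) D] x y
      by cases blast+
  qed
  ultimately show ?thesis
    using P Q C tangency_connected_Un[of P Q C] by (auto simp: packing_condition_def)
qed

section \<open>Maximal packings\<close>

text \<open>A violation of any clause would involve at most two circles, and these lie together in
  one member of the chain, along with a tangency path between them.\<close>

lemma packing_condition_Union_chain:
  assumes chain: "subset.chain {P. packing_condition K P} \<C>"
  shows "packing_condition K (\<Union>\<C>)"
proof -
  have mem: "packing_condition K P" if "P \<in> \<C>" for P
    using chain that by (auto simp: subset_chain_def)
  have common: "\<exists>P\<in>\<C>. X \<in> P \<and> Y \<in> P" if "X \<in> \<Union>\<C>" "Y \<in> \<Union>\<C>" for X Y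
    using chain that unfolding subset_chain_def by blast
  have "\<Union>\<C> \<subseteq> oriented_bianchi_circles K"
    using mem by (auto simp: packing_condition_def)
  moreover have "tangency_connected (\<Union>\<C>)"
    unfolding tangency_connected_def
  proof (intro ballI)
    let ?E = "\<lambda>S. {(X, Y). X \<in> S \<and> Y \<in> S \<and> tangent X Y}"
    fix X Y assume "X \<in> \<Union>\<C>" "Y \<in> \<Union>\<C>"
    then obtain P where P: "P \<in> \<C>" "X \<in> P" "Y \<in> P" using common by blast
    then have "(X, Y) \<in> (?E P)\<^sup>*"
      using mem by (auto simp: packing_condition_def tangency_connected_def)
    moreover have "(?E P)\<^sup>* \<subseteq> (?E (\<Union>\<C>))\<^sup>*" using P(1) by (intro rtrancl_mono) blast
    ultimately show "(X, Y) \<in> (?E (\<Union>\<C>))\<^sup>*" by blast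
  qed
  moreover have "pairwise (\<lambda>C D. disjnt (oc_interior C) (oc_interior D)) (\<Union>\<C>)"
    unfolding pairwise_def disjnt_def
  proof (intro ballI impI)
    fix X Y assume "X \<in> \<Union>\<C>" "Y \<in> \<Union>\<C>" "X \<noteq> Y"
    then show "oc_interior X \<inter> oc_interior Y = {}"
      using common packing_disjoint mem by metis
  qed
  moreover have "\<not> straddles (\<Union>\<C>) D" if D: "D \<in> oriented_bianchi_circles K" for D
  proof
    assume "straddles (\<Union>\<C>) D"
    then obtain X Y where XY: "X \<in> \<Union>\<C>" "Y \<in> \<Union>\<C>"
      "underlying X \<inter> oc_interior D \<noteq> {}" "underlying Y \<inter> oc_exterior D \<noteq> {}"
      unfolding straddles_def by blast
    then obtain P where P: "P \<in> \<C>" "X \<in> P" "Y \<in> P" using common by blast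
    then have "straddles P D" using XY unfolding straddles_def by blast
    then show False using mem P(1) D by (auto simp: packing_condition_def)
  qed
  ultimately show ?thesis by (simp add: packing_condition_def)
qed

text \<open>A single circle straddles another exactly when it crosses it, so this is where
  \<open>bianchi_circles_do_not_cross\<close> enters.\<close>

lemma packing_condition_singleton:
  assumes "imaginary_quadratic_field K" "K \<noteq> rat_adjoin (csqrt (-3))" "C \<in> oriented_bianchi_circles K"
  shows "packing_condition K {C}"
  using bianchi_circles_do_not_cross[OF assms] assms(3)
  by (auto simp: packing_condition_def tangency_connected_def straddles_def)

text \<open>Zorn's lemma runs over the admissible sets containing \<open>C\<close>; maximality among
  them is maximality outright, as every larger set still contains \<open>C\<close>.\<close>

lemma apollonian_packing_exists:
  assumes "imaginary_quadratic_field K" "K \<noteq> rat_adjoin (csqrt (-3))" "C \<in> oriented_bianchi_circles K"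
  obtains P where "apollonian_packing K P" "C \<in> P"
proof -
  let ?A = "{P. packing_condition K P \<and> C \<in> P}"
  have "\<exists>M\<in>?A. \<forall>X\<in>?A. M \<subseteq> X \<longrightarrow> X = M"
  proof (rule subset_Zorn_nonempty)
    show "?A \<noteq> {}" using packing_condition_singleton[OF assms] by blast
  next
    fix \<C> assume ne: "\<C> \<noteq> {}" and chain: "subset.chain ?A \<C>"
    have "subset.chain {P. packing_condition K P} \<C>"
      using chain unfolding subset_chain_def by blast
    moreover have "C \<in> \<Union>\<C>" using ne chain unfolding subset_chain_def by blast
    ultimately show "\<Union>\<C> \<in> ?A" using packing_condition_Union_chain by blast
  qed
  then obtain M where "packing_condition K M" "C \<in> M"
    "\<And>X. packing_condition K X \<Longrightarrow> C \<in> X \<Longrightarrow> M \<subseteq> X \<Longrightarrow> X = M" by blast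
  then show ?thesis by (intro that[of M]) (auto simp: apollonian_packing_def)
qed

lemma apollonian_packing_unique:
  assumes "apollonian_packing K P" "apollonian_packing K Q" "C \<in> P" "C \<in> Q"
  shows "P = Q"
proof -
  have "packing_condition K (P \<union> Q)"
    using packing_condition_Un assms by (auto simp: apollonian_packing_def)
  then have "P \<union> Q = P" "P \<union> Q = Q" using assms(1,2) unfolding apollonian_packing_def by blast+
  then show ?thesis by simp
qed

theorem theorem4p11:
  fixes K :: "complex set"
  assumes "imaginary_quadratic_field K"
    and "K \<noteq> rat_adjoin (csqrt (-3))"
  shows "(\<forall>P. apollonian_packing K P \<longrightarrow> P \<subseteq> oriented_bianchi_circles K) \<and>
         pairwise disjnt {P. apollonian_packing K P} \<and>
         \<Union> {P. apollonian_packing K P} = oriented_bianchi_circles K"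
proof (intro conjI)
  show sub: "\<forall>P. apollonian_packing K P \<longrightarrow> P \<subseteq> oriented_bianchi_circles K"
    by (auto simp: apollonian_packing_def packing_condition_def)
  show "pairwise disjnt {P. apollonian_packing K P}"
    using apollonian_packing_unique unfolding pairwise_def disjnt_def by blast
  show "\<Union> {P. apollonian_packing K P} = oriented_bianchi_circles K"
    using sub apollonian_packing_exists[OF assms] by blast
qed

end
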